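(* Let $n\geq 3$. There exist constants $C,C'>0$ and a smooth family of symplectic embeddings $$i_{S,R}\colon \mathrm{B}^2(1)\times\mathrm{B}^{2(n-1)}(S)\hookrightarrow \mathrm{B}^4(R)\times\mathrm{B}^{2(n-2)}\Big(\tfrac{CS^2}{\sqrt{R-\sqrt{3}}}\Big),$$ where the parameters $(S,R)$ range over the open set $\{(S,R)\in\mathbb{R}^2 : S>0,\ \sqrt{3}<R<\sqrt{3}+C'S^2\}$.
   Context: $\mathbb{R}^{2m}$, with coordinates $(x_1,y_1,\ldots,x_m,y_m)$, carries the standard symplectic form $\sum_i \mathrm{d}x_i\wedge\mathrm{d}y_i$, and $\mathrm{B}^{2m}(\rho)$ denotes the open ball of radius $\rho$ centered at the origin; products of balls are regarded as open subsets of $\mathbb{R}^{2n}$, and a symplectic embedding is a smooth embedding preserving the standard form. Smooth families: for smooth manifolds $P,M,N$ and submanifolds $B_p\subset N$, a family of embeddings $(\phi_p\colon B_p\hookrightarrow M)_{p\in P}$ is smooth if there is a smooth manifold $B$ and a smooth map $g\colon P\times B\to N$ with each $g(p,\cdot)$ an immersion and $B_p=g(p,B)$, such that $\Phi(p,b)=\phi_p(g(p,b))$ is smooth. The family is also called smooth when each $\phi_p$ takes values in a submanifold $M_p\subset M$ containing $\phi_p(B_p)$. Here $N=M=\mathbb{R}^{2n}$, $P$ is the given open set of parameters $(S,R)$, $B_{(S,R)}=\mathrm{B}^2(1)\times\mathrm{B}^{2(n-1)}(S)$, and $M_{(S,R)}=\mathrm{B}^4(R)\times\mathrm{B}^{2(n-2)}\big(CS^2/\sqrt{R-\sqrt{3}}\big)$.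 *)

theory Defs
  imports "HOL-Analysis.Analysis"
begin

text \<open>Points of R^(2n), n = CARD('k) + 2 (so n >= 3 automatically), written as
  ((x1,y1), (x2,y2), (xs, ys)) with xs, ys the coordinates x_3..x_n and y_3..y_n.
  The product norm is the Euclidean norm.\<close>
type_synonym 'k pt = "(real \<times> real) \<times> (real \<times> real) \<times> ((real^'k) \<times> (real^'k))"

fun omega :: "'k::finite pt \<Rightarrow> 'k pt \<Rightarrow> real" where
  "omega ((a1,b1),(a2,b2),(xs,ys)) ((c1,d1),(c2,d2),(us,vs)) =
     (a1*d1 - b1*c1) + (a2*d2 - b2*c2) + (\<Sum>i\<in>UNIV. xs$i * vs$i - ys$i * us$i)"

text \<open>Infinite (Frechet) differentiability on a set: there is a tower of iterated
  derivatives D k vs x (the k-th derivative at x applied to the directions vs),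
  each level being the Frechet derivative of the previous one.\<close>
definition smooth_on :: "('a::real_normed_vector \<Rightarrow> 'b::real_normed_vector) \<Rightarrow> 'a set \<Rightarrow> bool" where
  "smooth_on f S \<longleftrightarrow>
     (\<exists>D :: nat \<Rightarrow> 'a list \<Rightarrow> 'a \<Rightarrow> 'b.
        (\<forall>x\<in>S. D 0 [] x = f x) \<and>
        (\<forall>k vs x. length vs = k \<and> x \<in> S \<longrightarrow>
            ((\<lambda>y. D k vs y) has_derivative (\<lambda>v. D (Suc k) (v # vs) x)) (at x)))"

definition symplectic_embedding :: "('k::finite pt \<Rightarrow> 'k pt) \<Rightarrow> 'k pt set \<Rightarrow> bool" where
  "symplectic_embedding \<phi> U \<longleftrightarrow>
     inj_on \<phi> U \<and> (\<exists>\<psi>. homeomorphism U (\<phi> ` U) \<phi> \<psi>) \<and> smooth_on \<phi> U \<and>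
     (\<forall>z\<in>U. \<exists>L. (\<phi> has_derivative L) (at z) \<and> (\<forall>u v. omega (L u) (L v) = omega u v))"

definition source_set :: "real \<Rightarrow> 'k::finite pt set" where
  "source_set S = {z. norm (fst z) < 1 \<and> norm (snd z) < S}"

definition target_set :: "real \<Rightarrow> real \<Rightarrow> real \<Rightarrow> 'k::finite pt set" where
  "target_set C S R = {z. norm (fst z, fst (snd z)) < R \<and>
                          norm (snd (snd z)) < C * S\<^sup>2 / sqrt (R - sqrt 3)}"

definition param_set :: "real \<Rightarrow> (real \<times> real) set" where
  "param_set C' = {(S,R). S > 0 \<and> sqrt 3 < R \<and> R < sqrt 3 + C' * S\<^sup>2}"

end

theory Submission
  imports Defs
begin

text \<open>
  An open disc is an open rectangle up to an area preserving map, and so is a slit disc, via the polar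
  coordinates \<open>(r\<^sup>2 / 2, \<theta>)\<close>. So write the disc factor as \<open>(q, p)\<close> in a rectangle of area \<open>\<pi>\<close>, and describe
  the target ball by polar coordinates \<open>(q, p)\<close> and \<open>(I, \<theta>)\<close>: it is \<open>2 q + 2 I < R\<^sup>2\<close>.

  Shearing by the Hamiltonian \<open>g (y\<^sub>1) * y\<^sub>2\<close>, with \<open>g\<close> a staircase of small period, makes it possible to
  reduce \<open>(x\<^sub>1, y\<^sub>1)\<close> modulo a lattice of small area: a collision modulo the lattice is resolved by the
  coordinate \<open>x\<^sub>2\<close>. Because \<open>g\<close> only rises on short intervals, the reduced points lie in a punctured torus, the
  union of a band (\<open>y\<^sub>1\<close> in a rise) and a loop (\<open>\<bar>x\<^sub>1\<bar> < S\<close>) that cross in one square.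

  The punctured torus is immersed in the \<open>(I, \<theta>)\<close> cylinder: the band runs around once at height \<open>I \<approx> 1/2\<close>,
  the loop runs around twice, once below and once above the band. So the loop crosses the band a second time, and
  there it has to be displaced in the first factor, by raising \<open>q\<close> by \<open>1/2\<close>. The generating function of this
  displacement depends on \<open>\<theta> - p\<close> only, hence it lowers \<open>I\<close> by the amount by which it raises \<open>q\<close>. The sum
  \<open>q + I\<close> is therefore at most about \<open>1/2 + 1\<close>, which gives \<open>R\<^sup>2 \<approx> 3\<close>.
\<close>

section \<open>Smooth maps\<close>

text \<open>Once a derivative inside \<open>P\<close> has been chosen for every member of
  \<open>P\<close>, recursion on the list of directions builds the whole tower, so no formula for
  higher derivatives is ever needed.\<close>

lemma smooth_on_coinduct:
  assumes "P f"
    and step: "\<And>g. P g \<Longrightarrow> \<exists>g'. (\<forall>x\<in>S. (g has_derivative g' x) (at x)) \<and> (\<forall>v. P (\<lambda>x. g' x v))"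
  shows "smooth_on f S"
proof -
  obtain d where d: "\<And>g. P g \<Longrightarrow> (\<forall>x\<in>S. (g has_derivative d g x) (at x)) \<and> (\<forall>v. P (\<lambda>x. d g x v))"
    using step by metis
  define D where "D = rec_list f (\<lambda>v vs r x. d r x v)"
  have D: "D [] = f" "\<And>v vs. D (v # vs) = (\<lambda>x. d (D vs) x v)"
    by (simp_all add: D_def)
  have P: "P (D vs)" for vs
    by (induction vs) (use assms(1) d in \<open>auto simp: D\<close>)
  show ?thesis
    unfolding smooth_on_def
    by (rule exI[of _ "\<lambda>_. D"]) (use d[OF P] in \<open>auto simp: D\<close>)
qed

lemma smooth_onE:
  assumes "smooth_on f S" "open S"
  obtains f' where "\<And>x. x \<in> S \<Longrightarrow> (f has_derivative f' x) (at x)" "\<And>v. smooth_on (\<lambda>x. f' x v) S"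
proof -
  obtain D where D0: "\<And>x. x \<in> S \<Longrightarrow> D 0 [] x = f x"
    and D: "\<And>k vs x. length vs = k \<Longrightarrow> x \<in> S \<Longrightarrow> ((\<lambda>y. D k vs y) has_derivative (\<lambda>v. D (Suc k) (v # vs) x)) (at x)"
    using assms(1) unfolding smooth_on_def by metis
  show ?thesis
  proof (rule that[of "\<lambda>x v. D (Suc 0) [v] x"])
    show "(f has_derivative (\<lambda>v. D (Suc 0) [v] x)) (at x)" if "x \<in> S" for x
      using D[of "[]" 0 x] that by (auto intro: has_derivative_transform_within_open[OF _ assms(2)] simp: D0)
    \<comment> \<open>The newest direction stands at the head of the list, so the direction
      \<open>v\<close> of the very first differentiation is appended at its end.\<close>
    show "smooth_on (\<lambda>x. D (Suc 0) [v] x) S" for v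
      unfolding smooth_on_def
      by (rule exI[of _ "\<lambda>k vs. D (Suc k) (vs @ [v])"]) (use D in auto)
  qed
qed

lemma smooth_on_imp_continuous_on:
  assumes "smooth_on f S" "open S"
  shows "continuous_on S f"
  using smooth_onE[OF assms] has_derivative_continuous continuous_at_imp_continuous_on by metis

lemma smooth_on_cong:
  assumes "smooth_on f S" "\<And>x. x \<in> S \<Longrightarrow> f x = g x"
  shows "smooth_on g S"
  using assms unfolding smooth_on_def by auto

lemma smooth_on_subset: "smooth_on f T \<Longrightarrow> S \<subseteq> T \<Longrightarrow> smooth_on f S"
  unfolding smooth_on_def by blast

lemma smooth_on_const: "smooth_on (\<lambda>x. c) S"
  by (rule smooth_on_coinduct[where P = "\<lambda>g. \<exists>c. g = (\<lambda>x. c)"]) (auto intro!: exI[of _ "\<lambda>_ _. 0"])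

lemma smooth_on_bounded_linear:
  assumes "bounded_linear f"
  shows "smooth_on f S"
proof (rule smooth_on_coinduct[where P = "\<lambda>g. g = f \<or> (\<exists>c. g = (\<lambda>x. c))"])
  fix g assume "g = f \<or> (\<exists>c. g = (\<lambda>x. c))"
  then show "\<exists>g'. (\<forall>x\<in>S. (g has_derivative g' x) (at x)) \<and> (\<forall>v. (\<lambda>x. g' x v) = f \<or> (\<exists>c. (\<lambda>x. g' x v) = (\<lambda>x. c)))"
  proof
    assume "g = f"
    then show ?thesis
      by (intro exI[of _ "\<lambda>_. f"]) (auto intro: bounded_linear_imp_has_derivative assms)
  next
    assume "\<exists>c. g = (\<lambda>x. c)"
    then show ?thesis
      by (intro exI[of _ "\<lambda>_ _. 0"]) auto
  qed
qed simp

lemma smooth_on_linear_comp: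
  assumes "bounded_linear L" "smooth_on f S" "open S"
  shows "smooth_on (\<lambda>x. L (f x)) S"
proof (rule smooth_on_coinduct[where P = "\<lambda>g. \<exists>f. g = (\<lambda>x. L (f x)) \<and> smooth_on f S"])
  show "\<exists>h. (\<lambda>x. L (f x)) = (\<lambda>x. L (h x)) \<and> smooth_on h S"
    using assms by blast
next
  fix g assume "\<exists>f. g = (\<lambda>x. L (f x)) \<and> smooth_on f S"
  then obtain f where g: "g = (\<lambda>x. L (f x))" and f: "smooth_on f S" by blast
  obtain f' where f': "\<And>x. x \<in> S \<Longrightarrow> (f has_derivative f' x) (at x)" "\<And>v. smooth_on (\<lambda>x. f' x v) S"
    using smooth_onE[OF f assms(3)] by metis
  show "\<exists>g'. (\<forall>x\<in>S. (g has_derivative g' x) (at x)) \<and> (\<forall>v. \<exists>f. (\<lambda>x. g' x v) = (\<lambda>x. L (f x)) \<and> smooth_on f S)"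
  proof (rule exI[of _ "\<lambda>x v. L (f' x v)"], intro conjI ballI allI)
    show "(g has_derivative (\<lambda>v. L (f' x v))) (at x)" if "x \<in> S" for x
      unfolding g by (rule bounded_linear.has_derivative[OF assms(1) f'(1)[OF that]])
    show "\<exists>f. (\<lambda>x. L (f' x v)) = (\<lambda>x. L (f x)) \<and> smooth_on f S" for v
      using f'(2)[of v] by (intro exI[of _ "\<lambda>x. f' x v"]) simp
  qed
qed

text \<open>Derivatives on overlapping neighbourhoods agree by uniqueness, so
  \<open>frechet_derivative\<close> patches them together. This is needed for staircases, whose
  smooth formula changes from window to window.\<close>

lemma smooth_on_local:
  assumes "\<And>x. x \<in> S \<Longrightarrow> \<exists>T. open T \<and> x \<in> T \<and> smooth_on f T"
  shows "smooth_on f S"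
proof (rule smooth_on_coinduct[where P = "\<lambda>g. \<forall>x\<in>S. \<exists>T. open T \<and> x \<in> T \<and> smooth_on g T"])
  show "\<forall>x\<in>S. \<exists>T. open T \<and> x \<in> T \<and> smooth_on f T"
    using assms by blast
next
  fix g assume g: "\<forall>x\<in>S. \<exists>T. open T \<and> x \<in> T \<and> smooth_on g T"
  let ?g' = "\<lambda>x. frechet_derivative g (at x)"
  have *: "(g has_derivative ?g' x) (at x) \<and> (\<forall>v. \<exists>T. open T \<and> x \<in> T \<and> smooth_on (\<lambda>x. ?g' x v) T)"
    if x: "x \<in> S" for x
  proof -
    obtain T where T: "open T" "x \<in> T" "smooth_on g T"
      using g x by blast
    obtain h where h: "\<And>x. x \<in> T \<Longrightarrow> (g has_derivative h x) (at x)" "\<And>v. smooth_on (\<lambda>x. h x v) T"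
      using smooth_onE[OF T(3,1)] by metis
    have eq: "h y = ?g' y" if "y \<in> T" for y
      using frechet_derivative_at[OF h(1)[OF that]] .
    have "smooth_on (\<lambda>x. ?g' x v) T" for v
      by (rule smooth_on_cong[OF h(2)[of v]]) (simp add: eq)
    then show ?thesis
      using T h(1)[OF T(2)] eq[OF T(2)] by auto
  qed
  show "\<exists>g'. (\<forall>x\<in>S. (g has_derivative g' x) (at x)) \<and>
      (\<forall>v. \<forall>x\<in>S. \<exists>T. open T \<and> x \<in> T \<and> smooth_on (\<lambda>x. g' x v) T)"
    by (rule exI[of _ ?g']) (use * in blast)
qed

lemma smooth_on_Pair:
  assumes "smooth_on f S" "smooth_on g S" "open S"
  shows "smooth_on (\<lambda>x. (f x, g x)) S"
proof (rule smooth_on_coinduct[where P = "\<lambda>h. \<exists>f g. h = (\<lambda>x. (f x, g x)) \<and> smooth_on f S \<and> smooth_on g S"])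
  show "\<exists>f' g'. (\<lambda>x. (f x, g x)) = (\<lambda>x. (f' x, g' x)) \<and> smooth_on f' S \<and> smooth_on g' S"
    using assms by blast
next
  fix h :: "'a \<Rightarrow> 'b \<times> 'c"
  assume "\<exists>f g. h = (\<lambda>x. (f x, g x)) \<and> smooth_on f S \<and> smooth_on g S"
  then obtain f g where h: "h = (\<lambda>x. (f x, g x))" and f: "smooth_on f S" and g: "smooth_on g S"
    by blast
  obtain f' where f': "\<And>x. x \<in> S \<Longrightarrow> (f has_derivative f' x) (at x)" "\<And>v. smooth_on (\<lambda>x. f' x v) S"
    using smooth_onE[OF f assms(3)] by metis
  obtain g' where g': "\<And>x. x \<in> S \<Longrightarrow> (g has_derivative g' x) (at x)" "\<And>v. smooth_on (\<lambda>x. g' x v) S"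
    using smooth_onE[OF g assms(3)] by metis
  show "\<exists>h'. (\<forall>x\<in>S. (h has_derivative h' x) (at x)) \<and>
     (\<forall>v. \<exists>f g. (\<lambda>x. h' x v) = (\<lambda>x. (f x, g x)) \<and> smooth_on f S \<and> smooth_on g S)"
  proof (rule exI[of _ "\<lambda>x v. (f' x v, g' x v)"], intro conjI ballI allI)
    show "(h has_derivative (\<lambda>v. (f' x v, g' x v))) (at x)" if "x \<in> S" for x
      unfolding h using f'(1) g'(1) that by (intro has_derivative_Pair)
    show "\<exists>f g. (\<lambda>x. (f' x v, g' x v)) = (\<lambda>x. (f x, g x)) \<and> smooth_on f S \<and> smooth_on g S" for v
      using f'(2)[of v] g'(2)[of v] by (intro exI[of _ "\<lambda>x. f' x v"] exI[of _ "\<lambda>x. g' x v"]) auto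
  qed
qed

lemma smooth_on_vec:
  assumes "\<And>i. smooth_on (\<lambda>x. f x $ i) S" "open S"
  shows "smooth_on (f :: _ \<Rightarrow> real^'k) S"
proof (rule smooth_on_coinduct[where P = "\<lambda>h. \<forall>i. smooth_on (\<lambda>x. h x $ i) S"])
  show "\<forall>i. smooth_on (\<lambda>x. f x $ i) S"
    using assms by blast
next
  fix h :: "'a \<Rightarrow> real^'k"
  assume h: "\<forall>i. smooth_on (\<lambda>x. h x $ i) S"
  have "\<exists>f'. (\<forall>x\<in>S. ((\<lambda>x. h x $ i) has_derivative f' x) (at x)) \<and> (\<forall>v. smooth_on (\<lambda>x. f' x v) S)" for i
    using smooth_onE[OF h[rule_format] assms(2)] by metis
  then obtain f' where f': "\<And>i x. x\<in>S \<Longrightarrow> ((\<lambda>x. h x $ i) has_derivative f' i x) (at x)"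
    "\<And>i v. smooth_on (\<lambda>x. f' i x v) S"
    by metis
  show "\<exists>h'. (\<forall>x\<in>S. (h has_derivative h' x) (at x)) \<and> (\<forall>v. \<forall>i. smooth_on (\<lambda>x. h' x v $ i) S)"
  proof (rule exI[of _ "\<lambda>x v. \<chi> i. f' i x v"], intro conjI ballI allI)
    show "(h has_derivative (\<lambda>v. \<chi> i. f' i x v)) (at x)" if "x \<in> S" for x
      unfolding has_derivative_componentwise_within[of h]
      using f'(1)[OF that] by (auto simp: Basis_vec_def inner_axis)
  qed (use f' in auto)
qed

text \<open>Directional derivatives of smooth functions leave the class of, say, products of two smooth
  functions, but not the algebra generated by a set that is closed under differentiation up to that
  algebra; so coinduction is always carried out on such algebras.\<close>

inductive smooth_algebra :: "'a::real_normed_vector set \<Rightarrow> ('a \<Rightarrow> real) set \<Rightarrow> ('a \<Rightarrow> real) \<Rightarrow> bool"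
  for S B where
  generator: "b \<in> B \<Longrightarrow> smooth_algebra S B b"
| smooth: "smooth_on f S \<Longrightarrow> smooth_algebra S B f"
| add: "smooth_algebra S B f \<Longrightarrow> smooth_algebra S B g \<Longrightarrow> smooth_algebra S B (\<lambda>x. f x + g x)"
| mult: "smooth_algebra S B f \<Longrightarrow> smooth_algebra S B g \<Longrightarrow> smooth_algebra S B (\<lambda>x. f x * g x)"

lemma smooth_algebra_imp_smooth_on:
  assumes "smooth_algebra S B f" "open S"
    and B: "\<And>b. b \<in> B \<Longrightarrow> \<exists>b'. (\<forall>x\<in>S. (b has_derivative b' x) (at x)) \<and> (\<forall>v. smooth_algebra S B (\<lambda>x. b' x v))"
  shows "smooth_on f S"
proof (rule smooth_on_coinduct[where P = "smooth_algebra S B", OF assms(1)])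
  show "\<exists>g'. (\<forall>x\<in>S. (g has_derivative g' x) (at x)) \<and> (\<forall>v. smooth_algebra S B (\<lambda>x. g' x v))"
    if "smooth_algebra S B g" for g
    using that
  proof induction
    case (generator b)
    then show ?case by (rule B)
  next
    case (smooth f)
    then show ?case using smooth_onE[OF smooth assms(2)] smooth_algebra.smooth by metis
  next
    case (add f g)
    then obtain f' g' where
      "\<And>x. x\<in>S \<Longrightarrow> (f has_derivative f' x) (at x)" "\<And>v. smooth_algebra S B (\<lambda>x. f' x v)"
      "\<And>x. x\<in>S \<Longrightarrow> (g has_derivative g' x) (at x)" "\<And>v. smooth_algebra S B (\<lambda>x. g' x v)"
      by blast
    then show ?case
      by (intro exI[of _ "\<lambda>x v. f' x v + g' x v"]) (auto intro: has_derivative_add smooth_algebra.add)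
  next
    case (mult f g)
    then obtain f' g' where
      "\<And>x. x\<in>S \<Longrightarrow> (f has_derivative f' x) (at x)" "\<And>v. smooth_algebra S B (\<lambda>x. f' x v)"
      "\<And>x. x\<in>S \<Longrightarrow> (g has_derivative g' x) (at x)" "\<And>v. smooth_algebra S B (\<lambda>x. g' x v)"
      by blast
    then show ?case
      by (intro exI[of _ "\<lambda>x v. f x * g' x v + f' x v * g x"])
        (auto intro!: has_derivative_mult smooth_algebra.add smooth_algebra.mult mult.hyps)
  qed
qed

section \<open>Arithmetic, composition and elementary functions\<close>

lemma smooth_on_add:
  fixes f g :: "'a::real_normed_vector \<Rightarrow> real"
  assumes "smooth_on f S" "smooth_on g S" "open S"
  shows "smooth_on (\<lambda>x. f x + g x) S"
  by (rule smooth_algebra_imp_smooth_on[where B = "{}"])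
    (use assms in \<open>auto intro: smooth_algebra.intros\<close>)

lemma smooth_on_mult:
  fixes f g :: "'a::real_normed_vector \<Rightarrow> real"
  assumes "smooth_on f S" "smooth_on g S" "open S"
  shows "smooth_on (\<lambda>x. f x * g x) S"
  by (rule smooth_algebra_imp_smooth_on[where B = "{}"])
    (use assms in \<open>auto intro: smooth_algebra.intros\<close>)

text \<open>The generators are all compositions of \<open>f\<close> with functions smooth on
  \<open>T\<close>. By the chain rule, the derivative of a generator in direction \<open>v\<close>
  is the smooth function \<open>f' x v\<close> times another generator.\<close>

lemma smooth_on_compose:
  fixes f :: "'a::real_normed_vector \<Rightarrow> real" and \<phi> :: "real \<Rightarrow> real"
  assumes "smooth_on \<phi> T" "open T" "smooth_on f S" "open S" "f ` S \<subseteq> T"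
  shows "smooth_on (\<lambda>x. \<phi> (f x)) S"
proof (rule smooth_algebra_imp_smooth_on[where B = "{\<lambda>x. \<psi> (f x) | \<psi>. smooth_on \<psi> T}"])
  show "smooth_algebra S {\<lambda>x. \<psi> (f x) | \<psi>. smooth_on \<psi> T} (\<lambda>x. \<phi> (f x))"
    by (rule smooth_algebra.generator) (use assms in blast)
next
  fix b :: "'a \<Rightarrow> real" assume "b \<in> {\<lambda>x. \<psi> (f x) | \<psi>. smooth_on \<psi> T}"
  then obtain \<psi> where b: "b = (\<lambda>x. \<psi> (f x))" and \<psi>: "smooth_on \<psi> T" by blast
  obtain \<psi>' where \<psi>': "\<And>x. x \<in> T \<Longrightarrow> (\<psi> has_derivative \<psi>' x) (at x)" "\<And>v. smooth_on (\<lambda>x. \<psi>' x v) T"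
    using smooth_onE[OF \<psi> assms(2)] by metis
  obtain f' where f': "\<And>x. x \<in> S \<Longrightarrow> (f has_derivative f' x) (at x)" "\<And>v. smooth_on (\<lambda>x. f' x v) S"
    using smooth_onE[OF assms(3,4)] by metis
  have "((\<lambda>x. \<psi> (f x)) has_derivative (\<lambda>v. f' x v * \<psi>' (f x) 1)) (at x)" if "x \<in> S" for x
  proof -
    have "f x \<in> T" using that assms(5) by blast
    from \<psi>'(1)[OF this] have l: "\<psi>' (f x) r = r * \<psi>' (f x) 1" for r
      using linear_scale[OF has_derivative_linear, of \<psi> "\<psi>' (f x)" "at (f x)" r 1] by simp
    show ?thesis
      using has_derivative_compose[OF f'(1)[OF that] \<psi>'(1)[OF \<open>f x \<in> T\<close>]] by (simp add: l[symmetric])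
  qed
  moreover have "smooth_algebra S {\<lambda>x. \<psi> (f x) | \<psi>. smooth_on \<psi> T} (\<lambda>x. f' x v * \<psi>' (f x) 1)" for v
    by (intro smooth_algebra.mult[OF smooth_algebra.smooth smooth_algebra.generator] f')
      (use \<psi>'(2)[of 1] in \<open>auto intro!: exI[of _ "\<lambda>x. \<psi>' x 1"]\<close>)
  ultimately show "\<exists>b'. (\<forall>x\<in>S. (b has_derivative b' x) (at x)) \<and>
      (\<forall>v. smooth_algebra S {\<lambda>x. \<psi> (f x) | \<psi>. smooth_on \<psi> T} (\<lambda>x. b' x v))"
    unfolding b by (intro exI[of _ "\<lambda>x v. f' x v * \<psi>' (f x) 1"]) auto
qed (rule assms)

lemma smooth_on_real_algebra:
  fixes \<phi> :: "real \<Rightarrow> real"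
  assumes "\<phi> \<in> B" "open S"
    and B: "\<And>b. b \<in> B \<Longrightarrow> \<exists>b'. (\<forall>x\<in>S. (b has_real_derivative b' x) (at x)) \<and> smooth_algebra S B b'"
  shows "smooth_on \<phi> S"
proof (rule smooth_algebra_imp_smooth_on[OF smooth_algebra.generator[OF assms(1)] assms(2)])
  fix b assume "b \<in> B"
  then obtain b' where b': "\<And>x. x\<in>S \<Longrightarrow> (b has_real_derivative b' x) (at x)" "smooth_algebra S B b'"
    using B by blast
  show "\<exists>b'. (\<forall>x\<in>S. (b has_derivative b' x) (at x)) \<and> (\<forall>v. smooth_algebra S B (\<lambda>x. b' x v))"
    by (rule exI[of _ "\<lambda>x v. b' x * v"])
      (use b' in \<open>auto intro!: smooth_algebra.mult smooth_algebra.smooth[OF smooth_on_const]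
         simp: has_field_derivative_def\<close>)
qed

lemma smooth_on_real_derivative:
  fixes \<phi> \<phi>' :: "real \<Rightarrow> real"
  assumes "\<And>x. x \<in> S \<Longrightarrow> (\<phi> has_real_derivative \<phi>' x) (at x)" "smooth_on \<phi>' S" "open S"
  shows "smooth_on \<phi> S"
  by (rule smooth_on_real_algebra[where B = "{\<phi>}"])
    (use assms in \<open>auto intro: smooth_algebra.smooth\<close>)

lemma smooth_on_deriv:
  fixes \<phi> :: "real \<Rightarrow> real"
  assumes "smooth_on \<phi> S" "open S"
  shows "x \<in> S \<Longrightarrow> (\<phi> has_real_derivative deriv \<phi> x) (at x)" "smooth_on (deriv \<phi>) S"
proof -
  obtain \<phi>' where *: "\<And>x. x \<in> S \<Longrightarrow> (\<phi> has_derivative \<phi>' x) (at x)" "\<And>v. smooth_on (\<lambda>x. \<phi>' x v) S"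
    using smooth_onE[OF assms] by metis
  have d: "(\<phi> has_real_derivative \<phi>' x 1) (at x)" if "x \<in> S" for x
  proof (rule has_derivative_imp_has_field_derivative[OF *(1)[OF that]])
    show "r * \<phi>' x 1 = \<phi>' x r" for r
      using linear_scale[OF has_derivative_linear[OF *(1)[OF that]], of r 1] by (simp del: mult_cancel_right1)
  qed
  show "x \<in> S \<Longrightarrow> (\<phi> has_real_derivative deriv \<phi> x) (at x)"
    using d[of x] by (simp add: DERIV_imp_deriv[OF d])
  show "smooth_on (deriv \<phi>) S"
    by (rule smooth_on_cong[OF *(2)[of 1]]) (simp add: DERIV_imp_deriv[OF d])
qed

lemma smooth_on_sin: "smooth_on (sin :: real \<Rightarrow> real) UNIV"
  and smooth_on_cos: "smooth_on (cos :: real \<Rightarrow> real) UNIV"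
proof -
  have B: "\<exists>b'. (\<forall>x\<in>UNIV. (b has_real_derivative b' x) (at x)) \<and> smooth_algebra UNIV {sin, cos} b'"
    if "b \<in> {sin, cos}" for b :: "real \<Rightarrow> real"
  proof -
    have "smooth_algebra UNIV {sin, cos} (\<lambda>x::real. - 1 * sin x)"
      by (intro smooth_algebra.intros smooth_on_const) auto
    then have 1: "smooth_algebra UNIV {sin, cos} (\<lambda>x::real. - sin x)" by simp
    from that show ?thesis
    proof
      assume "b = sin"
      then show ?thesis by (intro exI[of _ cos]) (auto intro: smooth_algebra.generator)
    next
      assume "b \<in> {cos}"
      then show ?thesis by (intro exI[of _ "\<lambda>x. - sin x"]) (auto intro!: derivative_eq_intros 1)
    qed
  qed
  show "smooth_on (sin :: real \<Rightarrow> real) UNIV" "smooth_on (cos :: real \<Rightarrow> real) UNIV"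
    by (rule smooth_on_real_algebra[OF _ _ B]; simp)+
qed

lemma smooth_on_inverse: "smooth_on (inverse :: real \<Rightarrow> real) (- {0})"
proof (rule smooth_on_real_algebra[where B = "{inverse}"])
  fix b :: "real \<Rightarrow> real" assume b: "b \<in> {inverse}"
  have A: "smooth_algebra (- {0}) {inverse} (\<lambda>x::real. (- 1) * (inverse x * inverse x))"
    by (intro smooth_algebra.mult smooth_algebra.smooth[OF smooth_on_const] smooth_algebra.generator; simp)
  from b show "\<exists>b'. (\<forall>x\<in>- {0}. (b has_real_derivative b' x) (at x)) \<and> smooth_algebra (- {0}) {inverse} b'"
    by (intro exI[of _ "\<lambda>x. (- 1) * (inverse x * inverse x)"] conjI[OF _ A]) (auto intro!: derivative_eq_intros)
qed auto

text \<open>Adjoining the reciprocal closes the algebra: \<open>sqrt\<close> has derivative half the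
  reciprocal, and the reciprocal has derivative minus half its own cube.\<close>

lemma smooth_on_sqrt: "smooth_on sqrt {0<..}"
proof (rule smooth_on_real_algebra[where B = "{sqrt, \<lambda>x. inverse (sqrt x)}"])
  fix b :: "real \<Rightarrow> real" assume b: "b \<in> {sqrt, \<lambda>x. inverse (sqrt x)}"
  let ?A = "smooth_algebra {0<..} {sqrt, \<lambda>x. inverse (sqrt x)}"
  have A: "?A (\<lambda>x. 1/2 * inverse (sqrt x))"
    "?A (\<lambda>x. (- 1/2) * (inverse (sqrt x) * (inverse (sqrt x) * inverse (sqrt x))))"
    by (intro smooth_algebra.mult smooth_algebra.smooth[OF smooth_on_const] smooth_algebra.generator; simp)+
  from b show "\<exists>b'. (\<forall>x\<in>{0<..}. (b has_real_derivative b' x) (at x)) \<and> ?A b'"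
  proof
    assume "b = sqrt"
    then show ?thesis
      by (intro exI[of _ "\<lambda>x. 1/2 * inverse (sqrt x)"] conjI[OF _ A(1)]) (auto intro!: derivative_eq_intros)
  next
    assume "b \<in> {\<lambda>x. inverse (sqrt x)}"
    then show ?thesis
      by (intro exI[of _ "\<lambda>x. (- 1/2) * (inverse (sqrt x) * (inverse (sqrt x) * inverse (sqrt x)))"] conjI[OF _ A(2)]) (auto intro!: derivative_eq_intros simp: field_simps)
  qed
qed auto

lemma smooth_on_diff:
  fixes f g :: "'a::real_normed_vector \<Rightarrow> real"
  assumes "smooth_on f S" "smooth_on g S" "open S"
  shows "smooth_on (\<lambda>x. f x - g x) S"
  using smooth_on_add[OF assms(1) smooth_on_mult[OF smooth_on_const[of "-1"] assms(2,3)] assms(3)] by simp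

lemma smooth_on_divide:
  fixes f g :: "'a::real_normed_vector \<Rightarrow> real"
  assumes "smooth_on f S" "smooth_on g S" "open S" "\<And>x. x \<in> S \<Longrightarrow> g x \<noteq> 0"
  shows "smooth_on (\<lambda>x. f x / g x) S"
  unfolding divide_inverse
  by (intro smooth_on_mult smooth_on_compose[OF smooth_on_inverse] assms) (use assms(4) in auto)

lemma smooth_on_sqrt_comp:
  assumes "smooth_on f S" "open S" "\<And>x. x \<in> S \<Longrightarrow> f x > 0"
  shows "smooth_on (\<lambda>x. sqrt (f x)) S"
  by (intro smooth_on_compose[OF smooth_on_sqrt] assms) (use assms(3) in auto)

section \<open>Smooth staircases and the area of disc segments\<close>

text \<open>The classical flat function is the case \<open>n = 0\<close>. The negative powers are
  included so that the family is closed under differentiation up to linear combinations.\<close>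

definition flat :: "nat \<Rightarrow> real \<Rightarrow> real" where
  "flat n x = (if x \<le> 0 then 0 else exp (- 1 / x) / x ^ n)"

lemma flat_has_derivative:
  "(flat n has_real_derivative flat (n + 2) x - real n * flat (n + 1) x) (at x)"
proof -
  consider "x > 0" | "x < 0" | "x = 0" by linarith
  then show ?thesis
  proof cases
    case 1
    have "((\<lambda>x. exp (- 1 / x) / x ^ n) has_real_derivative flat (n + 2) x - real n * flat (n + 1) x) (at x)"
    proof (cases n)
      case 0
      then show ?thesis
        using 1 by (auto intro!: derivative_eq_intros simp: flat_def field_simps power2_eq_square)
    next
      case (Suc k)
      have "((\<lambda>x. exp (- 1 / x) / x ^ n) has_real_derivative
          (exp (- 1 / x) * (1 / x\<^sup>2) * x ^ n - exp (- 1 / x) * (real n * x ^ (n - Suc 0))) / (x ^ n * x ^ n)) (at x)"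
        by (rule DERIV_divide DERIV_pow | use 1 in \<open>auto intro!: derivative_eq_intros simp: power2_eq_square\<close>)+
      moreover have "(exp (- 1 / x) * (1 / x\<^sup>2) * x ^ n - exp (- 1 / x) * (real n * x ^ (n - Suc 0))) / (x ^ n * x ^ n)
          = flat (n + 2) x - real n * flat (n + 1) x"
        using 1 by (simp add: Suc flat_def field_simps power2_eq_square)
      ultimately show ?thesis
        by (simp only:)
    qed
    then show ?thesis
      by (rule has_field_derivative_transform_within_open[of _ _ _ "{0<..}"]) (use 1 in \<open>auto simp: flat_def\<close>)
  next
    case 2
    have "((\<lambda>x. 0) has_real_derivative 0) (at x)" by simp
    then have "(flat n has_real_derivative 0) (at x)"
      by (rule has_field_derivative_transform_within_open[of _ _ _ "{..<0}"]) (use 2 in \<open>auto simp: flat_def\<close>)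
    then show ?thesis using 2 by (simp add: flat_def)
  next
    case 3
    \<comment> \<open>For h > 0 and t = 1/h the difference quotient at 0 is t^(n+1) / exp t, which
      tends to 0 as t grows.\<close>
    have "((\<lambda>h. inverse h ^ Suc n / exp (inverse h)) \<longlongrightarrow> 0) (at_right (0::real))"
      by (rule filterlim_compose[OF tendsto_power_div_exp_0 filterlim_inverse_at_top_right])
    then have "((\<lambda>h. flat n h / h) \<longlongrightarrow> 0) (at_right 0)"
      by (rule Lim_transform_eventually)
        (auto simp: eventually_at_filter flat_def field_simps exp_minus)
    moreover have "((\<lambda>h. flat n h / h) \<longlongrightarrow> 0) (at_left 0)"
      by (rule tendsto_eventually) (auto simp: eventually_at_filter flat_def)
    ultimately have "((\<lambda>h. flat n h / h) \<longlongrightarrow> 0) (at 0)"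
      by (simp add: filterlim_split_at)
    then show ?thesis
      using 3 by (simp add: DERIV_def flat_def)
  qed
qed

lemma smooth_on_flat: "smooth_on (flat n) UNIV"
proof (rule smooth_on_real_algebra[where B = "range flat"])
  fix b assume "b \<in> range flat"
  then obtain n where b: "b = flat n" by blast
  have "smooth_algebra UNIV (range flat) (\<lambda>x. flat (n + 2) x + (- real n) * flat (n + 1) x)"
    by (intro smooth_algebra.add smooth_algebra.mult smooth_algebra.smooth[OF smooth_on_const]
        smooth_algebra.generator rangeI)
  then show "\<exists>b'. (\<forall>x\<in>UNIV. (b has_real_derivative b' x) (at x)) \<and> smooth_algebra UNIV (range flat) b'"
    using flat_has_derivative[of n]
    by (intro exI[of _ "\<lambda>x. flat (n + 2) x + (- real n) * flat (n + 1) x"]) (simp add: b)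
qed auto

definition smooth_step :: "real \<Rightarrow> real" where
  "smooth_step x = flat 0 x / (flat 0 x + flat 0 (1 - x))"

lemma flat_denominator_pos: "flat 0 x + flat 0 (1 - x) > 0"
  by (auto simp: flat_def intro: add_pos_pos)

lemma smooth_on_smooth_step: "smooth_on smooth_step UNIV"
  unfolding smooth_step_def[abs_def]
  by (intro smooth_on_divide smooth_on_add smooth_on_flat smooth_on_compose[OF smooth_on_flat[of 0]]
      smooth_on_diff smooth_on_const smooth_on_bounded_linear bounded_linear_ident)
    (use flat_denominator_pos in \<open>auto simp: less_imp_neq[symmetric]\<close>)

lemma smooth_step_bounds: "0 \<le> smooth_step x" "smooth_step x \<le> 1"
  using flat_denominator_pos[of x] by (auto simp: smooth_step_def divide_le_eq flat_def intro!: divide_nonneg_pos)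

lemma smooth_step_eq_0: "x \<le> 0 \<Longrightarrow> smooth_step x = 0"
  by (simp add: smooth_step_def flat_def)

lemma smooth_step_eq_1: "1 \<le> x \<Longrightarrow> smooth_step x = 1"
  using flat_denominator_pos[of x] by (simp add: smooth_step_def flat_def)

text \<open>At these points, end points included, the step attains its global minimum 0 or its
  global maximum 1.\<close>

lemma deriv_smooth_step_eq_0:
  assumes "\<not> (0 < x \<and> x < 1)"
  shows "deriv smooth_step x = 0"
proof -
  have d: "(smooth_step has_real_derivative deriv smooth_step x) (at x)"
    using smooth_on_deriv(1)[OF smooth_on_smooth_step] by simp
  show ?thesis
  proof (cases "x \<le> 0")
    case True
    then show ?thesis
      by (intro DERIV_local_min[OF d zero_less_one]) (simp add: smooth_step_eq_0 smooth_step_bounds)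
  next
    case False
    with assms show ?thesis
      by (intro DERIV_local_max[OF d zero_less_one]) (simp add: smooth_step_eq_1 smooth_step_bounds)
  qed
qed

text \<open>A smoothed floor function: on \<open>[n, n + 1]\<close> it rises from \<open>n\<close> to \<open>n + 1\<close> within \<open>[n, n + a]\<close> and is constant
  afterwards.\<close>

definition stair :: "real \<Rightarrow> real \<Rightarrow> real" where
  "stair a x = of_int \<lfloor>x\<rfloor> + smooth_step (frac x / a)"

definition stair' :: "real \<Rightarrow> real \<Rightarrow> real" where
  "stair' a x = deriv smooth_step (frac x / a) / a"

lemma stair_add_int: "stair a (x + of_int k) = stair a x + of_int k"
  and stair'_add_int: "stair' a (x + of_int k) = stair' a x"
  by (auto simp: stair_def stair'_def frac_def)

text \<open>One formula serves on both sides of the integer \<open>n\<close>, because just before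
  \<open>n\<close> the previous step is complete and the next one has not begun. For
  \<open>a < 1\<close> the interiors of these windows cover the line, which removes the floor
  function from all questions of smoothness.\<close>

lemma stair_local:
  assumes "0 < a" "of_int n - 1 + a \<le> x" "x < of_int n + 1"
  shows "stair a x = of_int n + smooth_step ((x - of_int n) / a)"
    and "stair' a x = deriv smooth_step ((x - of_int n) / a) / a"
proof -
  have "stair a x = of_int n + smooth_step ((x - of_int n) / a) \<and>
    stair' a x = deriv smooth_step ((x - of_int n) / a) / a"
  proof (cases "of_int n \<le> x")
    case True
    then have "\<lfloor>x\<rfloor> = n" using assms by linarith
    then show ?thesis by (simp add: stair_def stair'_def frac_def)
  next
    case False
    then have "\<lfloor>x\<rfloor> = n - 1" using assms by linarith
    moreover have "1 \<le> (x - (of_int n - 1)) / a" "(x - of_int n) / a < 0"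
      using assms False by (auto simp: field_simps)
    ultimately show ?thesis
      by (simp add: stair_def stair'_def frac_def smooth_step_eq_0 smooth_step_eq_1 deriv_smooth_step_eq_0)
  qed
  then show "stair a x = of_int n + smooth_step ((x - of_int n) / a)"
    "stair' a x = deriv smooth_step ((x - of_int n) / a) / a" by auto
qed

lemma stair_flat:
  assumes "0 < a" "a < 1" "of_int n - 1 + a \<le> x" "x \<le> of_int n"
  shows "stair a x = of_int n" "stair' a x = 0"
  using stair_local[of a n x] assms
  by (auto simp: smooth_step_eq_0 deriv_smooth_step_eq_0 divide_nonpos_pos not_less)

lemma stair_bounds: "of_int \<lfloor>x\<rfloor> \<le> stair a x" "stair a x \<le> of_int \<lfloor>x\<rfloor> + 1"
  using smooth_step_bounds by (auto simp: stair_def)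

lemma stair'_eq_0:
  assumes "0 < a" "\<not> (0 < frac x \<and> frac x < a)"
  shows "stair' a x = 0"
  using assms by (simp add: stair'_def deriv_smooth_step_eq_0 field_simps)

lemma stair_has_derivative:
  assumes "0 < a" "a < 1"
  shows "(stair a has_real_derivative stair' a x) (at x)"
proof -
  let ?n = "\<lfloor>x\<rfloor>"
  have x: "of_int ?n - 1 + a < x" "x < of_int ?n + 1"
    using assms by linarith+
  have d: "((\<lambda>z. (z - of_int ?n) / a) has_real_derivative 1 / a) (at x)"
    using assms by (auto intro!: derivative_eq_intros)
  have "((\<lambda>x. of_int ?n + smooth_step ((x - of_int ?n) / a)) has_real_derivative stair' a x) (at x)"
    unfolding stair_local(2)[OF assms(1) less_imp_le[OF x(1)] x(2)]
    using DERIV_add[OF DERIV_const DERIV_chain2[OF smooth_on_deriv(1)[OF smooth_on_smooth_step] d]] by simp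
  then show ?thesis
    by (rule has_field_derivative_transform_within_open[of _ _ _ "{of_int ?n - 1 + a<..<of_int ?n + 1}"])
      (use x assms stair_local(1)[of a ?n] in auto)
qed

text \<open>The width \<open>a\<close> varies too, since in the family it depends on the parameters.
  Near each point the integer in \<open>stair_local\<close> can be kept fixed.\<close>

lemma smooth_on_stair:
  assumes u: "smooth_on u S" and a: "smooth_on a S" and "open S" and a01: "\<And>x. x \<in> S \<Longrightarrow> 0 < a x \<and> a x < 1"
  shows "smooth_on (\<lambda>x. stair (a x) (u x)) S" "smooth_on (\<lambda>x. stair' (a x) (u x)) S"
proof -
  have loc: "\<exists>T. open T \<and> z \<in> T \<and> smooth_on (\<lambda>x. stair (a x) (u x)) T \<and> smooth_on (\<lambda>x. stair' (a x) (u x)) T"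
    if z: "z \<in> S" for z
  proof -
    define n where "n = \<lfloor>u z\<rfloor>"
    define T where "T = {x \<in> S. 0 < u x - (of_int n - 1 + a x) \<and> u x - (of_int n + 1) < 0}"
    have c: "continuous_on S u" "continuous_on S a"
      using smooth_on_imp_continuous_on \<open>open S\<close> u a by blast+
    have "T = (S \<inter> (\<lambda>x. u x - (of_int n - 1 + a x)) -` {0<..}) \<inter> (S \<inter> (\<lambda>x. u x - (of_int n + 1)) -` {..<0})"
      by (auto simp: T_def)
    moreover have "open \<dots>"
      by (rule open_Int; rule continuous_open_preimage)
        (use c in \<open>auto intro!: continuous_intros \<open>open S\<close>\<close>)
    ultimately have T: "open T" by simp
    have "T \<subseteq> S" by (auto simp: T_def)
    note sub = smooth_on_subset[OF _ this]
    have "a x \<noteq> 0" if "x \<in> T" for x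
      using a01[of x] that by (auto simp: T_def)
    then have w: "smooth_on (\<lambda>x. (u x - of_int n) / a x) T"
      by (intro smooth_on_divide smooth_on_diff smooth_on_const sub[OF u] sub[OF a] T)
    have "smooth_on (\<lambda>x. of_int n + smooth_step ((u x - of_int n) / a x)) T"
      by (intro smooth_on_add smooth_on_const smooth_on_compose[OF smooth_on_smooth_step _ w] T) auto
    then have 1: "smooth_on (\<lambda>x. stair (a x) (u x)) T"
      by (rule smooth_on_cong[OF _ stair_local(1)[symmetric]]) (use a01 in \<open>auto simp: T_def less_imp_le\<close>)
    have "smooth_on (\<lambda>x. deriv smooth_step ((u x - of_int n) / a x) / a x) T"
      by (intro smooth_on_divide smooth_on_compose[OF smooth_on_deriv(2)[OF smooth_on_smooth_step] _ w]
          sub[OF a] T) (use \<open>\<And>x. x \<in> T \<Longrightarrow> a x \<noteq> 0\<close> in auto)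
    then have 2: "smooth_on (\<lambda>x. stair' (a x) (u x)) T"
      by (rule smooth_on_cong[OF _ stair_local(2)[symmetric]]) (use a01 in \<open>auto simp: T_def less_imp_le\<close>)
    have "of_int n \<le> u z" "u z < of_int n + 1"
      by (simp_all add: n_def)
    then have "z \<in> T"
      using a01[OF z] z by (auto simp: T_def)
    then show ?thesis
      using 1 2 T by blast
  qed
  show "smooth_on (\<lambda>x. stair (a x) (u x)) S" "smooth_on (\<lambda>x. stair' (a x) (u x)) S"
    by (rule smooth_on_local, use loc in blast)+
qed

lemma stair'_has_derivative:
  assumes "0 < a" "a < 1"
  shows "\<exists>d. (stair' a has_real_derivative d) (at x)"
proof -
  have "smooth_on (\<lambda>x. stair' a x) UNIV"
    by (rule smooth_on_stair(2)[OF smooth_on_bounded_linear[OF bounded_linear_ident] smooth_on_const]) (use assms in auto)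
  then show ?thesis
    using smooth_on_deriv(1)[of "stair' a" UNIV x] by auto
qed

text \<open>The fraction of the area of the unit disc that lies below height \<open>y\<close>.\<close>

definition disc_area :: "real \<Rightarrow> real" where
  "disc_area y = (y * sqrt (1 - y\<^sup>2) + arcsin y) / pi + 1 / 2"

lemma disc_area_has_derivative:
  assumes "\<bar>y\<bar> < 1"
  shows "(disc_area has_real_derivative 2 / pi * sqrt (1 - y\<^sup>2)) (at y)"
proof -
  have "y\<^sup>2 < 1"
    using assms by (simp add: abs_square_less_1)
  then have pos: "0 < sqrt (1 - y\<^sup>2)" by simp
  have "(disc_area has_real_derivative
      (sqrt (1 - y\<^sup>2) - y * y / sqrt (1 - y\<^sup>2) + inverse (sqrt (1 - y\<^sup>2))) / pi) (at y)"
    unfolding disc_area_def using assms \<open>y\<^sup>2 < 1\<close>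
    by (auto intro!: derivative_eq_intros simp: field_simps)
  also have "sqrt (1 - y\<^sup>2) - y * y / sqrt (1 - y\<^sup>2) + inverse (sqrt (1 - y\<^sup>2)) = 2 * sqrt (1 - y\<^sup>2)"
  proof -
    have "sqrt (1 - y\<^sup>2) * sqrt (1 - y\<^sup>2) = 1 - y * y"
      using \<open>y\<^sup>2 < 1\<close> by (simp add: power2_eq_square)
    then show ?thesis using pos by (simp add: field_simps)
  qed
  finally show ?thesis by simp
qed

lemma smooth_on_sqrt_disc: "smooth_on (\<lambda>y. sqrt (1 - y\<^sup>2)) {-1<..<1}"
proof -
  have "smooth_on (\<lambda>y::real. sqrt (1 - y * y)) {-1<..<1}"
    by (intro smooth_on_sqrt_comp smooth_on_diff smooth_on_mult smooth_on_const
        smooth_on_bounded_linear[OF bounded_linear_ident])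
      (auto simp: power2_eq_square[symmetric] abs_square_less_1)
  then show ?thesis by (simp add: power2_eq_square)
qed

lemma smooth_on_disc_area: "smooth_on disc_area {-1<..<1}"
  by (rule smooth_on_real_derivative[where \<phi>' = "\<lambda>y. 2 / pi * sqrt (1 - y\<^sup>2)"])
    (use smooth_on_mult[OF smooth_on_const[of "2 / pi"] smooth_on_sqrt_disc] in \<open>auto intro: disc_area_has_derivative simp del: times_divide_eq_left\<close>)

lemma disc_area_strict_mono:
  assumes "-1 \<le> x" "x < y" "y \<le> 1"
  shows "disc_area x < disc_area y"
proof (rule DERIV_pos_imp_increasing_open[OF assms(2)])
  fix t assume "x < t" "t < y"
  then have "\<bar>t\<bar> < 1" using assms by linarith
  then show "\<exists>d. (disc_area has_real_derivative d) (at t) \<and> 0 < d"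
    using disc_area_has_derivative[of t] by (intro exI[of _ "2 / pi * sqrt (1 - t\<^sup>2)"]) (auto simp: abs_square_less_1)
next
  show "continuous_on {x..y} disc_area"
    unfolding disc_area_def by (intro continuous_intros) (use assms in auto)
qed

lemma disc_area_bounds:
  assumes "\<bar>y\<bar> < 1"
  shows "0 < disc_area y" "disc_area y < 1"
  using disc_area_strict_mono[of "-1" y] disc_area_strict_mono[of y 1] assms
  by (auto simp: disc_area_def)

section \<open>Elementary symplectic maps\<close>

lemma omega_eq:
  "omega u v =
     (fst (fst u) * snd (fst v) - snd (fst u) * fst (fst v)) +
     (fst (fst (snd u)) * snd (fst (snd v)) - snd (fst (snd u)) * fst (fst (snd v))) +
     (fst (snd (snd u)) \<bullet> snd (snd (snd v)) - snd (snd (snd u)) \<bullet> fst (snd (snd v)))"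
  by (cases "(u, v)" rule: omega.cases) (simp add: inner_vec_def sum_subtractf)

definition symplectic_at :: "('k::finite pt \<Rightarrow> 'k pt) \<Rightarrow> 'k pt \<Rightarrow> bool" where
  "symplectic_at \<phi> z \<longleftrightarrow>
     (\<exists>L. (\<phi> has_derivative L) (at z) \<and> (\<forall>u v. omega (L u) (L v) = omega u v))"

lemma symplectic_at_compose:
  assumes "symplectic_at \<phi> z" "symplectic_at \<psi> (\<phi> z)"
  shows "symplectic_at (\<lambda>z. \<psi> (\<phi> z)) z"
proof -
  obtain L M where "(\<phi> has_derivative L) (at z)" "\<And>u v. omega (L u) (L v) = omega u v"
    "(\<psi> has_derivative M) (at (\<phi> z))" "\<And>u v. omega (M u) (M v) = omega u v"
    using assms unfolding symplectic_at_def by blast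
  then show ?thesis
    unfolding symplectic_at_def by (intro exI[of _ "\<lambda>x. M (L x)"]) (auto intro: has_derivative_compose)
qed

text \<open>If \<open>F\<close> is an antiderivative of the width \<open>\<rho>\<close> of the horizontal slices of a planar domain, then
  \<open>(x, y) \<mapsto> (x / \<rho> y, F y)\<close> is area preserving and maps the domain onto a rectangle.\<close>

definition rectify :: "real \<Rightarrow> (real \<Rightarrow> real) \<Rightarrow> (real \<Rightarrow> real) \<Rightarrow> 'k::finite pt \<Rightarrow> 'k pt" where
  "rectify c \<rho> F z = ((c + fst (fst z) / \<rho> (snd (fst z)), F (snd (fst z))), snd z)"

lemma symplectic_at_rectify:
  assumes "(\<rho> has_real_derivative d) (at (snd (fst z)))"
    and "(F has_real_derivative \<rho> (snd (fst z))) (at (snd (fst z)))" "\<rho> (snd (fst z)) \<noteq> 0"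
  shows "symplectic_at (rectify c \<rho> F) z"
proof -
  let ?r = "\<rho> (snd (fst z))"
  define L :: "'a pt \<Rightarrow> 'a pt" where
    "L h = ((fst (fst h) / ?r - fst (fst z) * (snd (fst h) * d) / (?r * ?r), snd (fst h) * ?r), snd h)" for h
  have 1: "((\<lambda>z. \<rho> (snd (fst z))) has_derivative (\<lambda>h. snd (fst h) * d)) (at z)"
    by (rule DERIV_compose_FDERIV[where f = "\<rho>"], rule assms(1)) (auto intro!: derivative_eq_intros)
  have 2: "((\<lambda>z. F (snd (fst z))) has_derivative (\<lambda>h. snd (fst h) * ?r)) (at z)"
    by (rule DERIV_compose_FDERIV[where f = "F"], rule assms(2)) (auto intro!: derivative_eq_intros)
  have "(rectify c \<rho> F has_derivative L) (at z)"
    unfolding rectify_def[abs_def] L_def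
    by (auto intro!: derivative_eq_intros 1 2 simp: assms fun_eq_iff field_simps)
  moreover have "omega (L u) (L v) = omega u v" for u v
    using assms(3) by (simp add: omega_eq L_def field_simps)
  ultimately show ?thesis
    unfolding symplectic_at_def by blast
qed

text \<open>With \<open>g'\<close> the derivative of \<open>g\<close>, this is the time-one map of
  the Hamiltonian of the overview, where (x_1, y_1) is the second factor and (x_2, y_2) is component
  \<open>i\<close> of the last one.\<close>

definition shear :: "'k::finite \<Rightarrow> (real \<Rightarrow> real) \<Rightarrow> (real \<Rightarrow> real) \<Rightarrow> 'k pt \<Rightarrow> 'k pt" where
  "shear i g g' z = (fst z,
     (fst (fst (snd z)) + g' (snd (fst (snd z))) * snd (snd (snd z)) $ i, snd (fst (snd z))),
     (fst (snd (snd z)) + g (snd (fst (snd z))) *\<^sub>R axis i 1, snd (snd (snd z))))"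

text \<open>The shear adds \<open>g'\<close> times dy_2 to dx_1 and \<open>g'\<close> times dy_1 to
  dx_2; the two new terms of the form cancel by antisymmetry. The term with the second derivative
  \<open>d\<close> is a multiple of dy_1 and vanishes against dy_1.\<close>

lemma symplectic_at_shear:
  assumes "(g has_real_derivative g' (snd (fst (snd z)))) (at (snd (fst (snd z))))"
    and "(g' has_real_derivative d) (at (snd (fst (snd z))))"
  shows "symplectic_at (shear i g g') z"
proof -
  let ?y = "snd (fst (snd z))"
  define L :: "'a pt \<Rightarrow> 'a pt" where
    "L h = (fst h, (fst (fst (snd h)) + (g' ?y * snd (snd (snd h)) $ i + snd (fst (snd h)) * d * snd (snd (snd z)) $ i), snd (fst (snd h))),
       (fst (snd (snd h)) + (snd (fst (snd h)) * g' ?y) *\<^sub>R axis i 1, snd (snd (snd h))))" for h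
  have 1: "((\<lambda>z. g (snd (fst (snd z)))) has_derivative (\<lambda>h. snd (fst (snd h)) * g' ?y)) (at z)"
    by (rule DERIV_compose_FDERIV[where f = "g"], rule assms(1)) (auto intro!: derivative_eq_intros)
  have 2: "((\<lambda>z. g' (snd (fst (snd z)))) has_derivative (\<lambda>h. snd (fst (snd h)) * d)) (at z)"
    by (rule DERIV_compose_FDERIV[where f = "g'"], rule assms(2)) (auto intro!: derivative_eq_intros)
  have 3: "((\<lambda>z. snd (snd (snd z)) $ i) has_derivative (\<lambda>h. snd (snd (snd h)) $ i)) (at z)"
    by (rule bounded_linear.has_derivative[OF bounded_linear_vec_nth]) (auto intro!: derivative_eq_intros)
  have "(shear i g g' has_derivative L) (at z)"
    unfolding shear_def[abs_def] L_def
    by (auto intro!: derivative_eq_intros 1 2 3 simp: fun_eq_iff)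
  moreover have "omega (L u) (L v) = omega u v" for u v
    by (simp add: omega_eq L_def inner_axis' inner_axis inner_add_left inner_add_right algebra_simps)
  ultimately show ?thesis
    unfolding symplectic_at_def by blast
qed

text \<open>The displacement \<open>\<sigma>\<close> and the turning \<open>\<eta>\<close> of the angle do not commute: the map is symplectic only where
  one of them is locally constant.\<close>

definition wrap :: "real \<Rightarrow> real \<Rightarrow> real \<Rightarrow> (real \<Rightarrow> real) \<Rightarrow> (real \<Rightarrow> real) \<Rightarrow> (real \<Rightarrow> real) \<Rightarrow> 'k::finite pt \<Rightarrow> 'k pt" where
  "wrap b m c \<eta> v \<sigma> z = (let (q, p) = fst z; (x, y) = fst (snd z); s = \<sigma> (y / b - p); t = y / b + \<eta> x in
     ((q + s, p), (c + b * x - m * t + v y - s, t), snd (snd z)))"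

lemma symplectic_at_wrap:
  assumes "(\<eta> has_real_derivative \<eta>') (at (fst (fst (snd z))))"
    and "(v has_real_derivative v') (at (snd (fst (snd z))))"
    and "(\<sigma> has_real_derivative \<sigma>') (at (snd (fst (snd z)) / b - snd (fst z)))"
    and "\<eta>' = 0 \<or> (v' = 0 \<and> \<sigma>' = 0)" "b \<noteq> 0"
  shows "symplectic_at (wrap b m c \<eta> v \<sigma>) z"
proof -
  define L :: "'a pt \<Rightarrow> 'a pt" where
    "L h = (let (q, p) = fst h; (x, y) = fst (snd h); s = (y / b - p) * \<sigma>'; t = y / b + x * \<eta>' in
       ((q + s, p), (b * x - m * t + y * v' - s, t), snd (snd h)))" for h
  have 1: "((\<lambda>z. \<eta> (fst (fst (snd z)))) has_derivative (\<lambda>h. fst (fst (snd h)) * \<eta>')) (at z)"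
    by (rule DERIV_compose_FDERIV[where f = "\<eta>"], rule assms(1)) (auto intro!: derivative_eq_intros)
  have 2: "((\<lambda>z. v (snd (fst (snd z)))) has_derivative (\<lambda>h. snd (fst (snd h)) * v')) (at z)"
    by (rule DERIV_compose_FDERIV[where f = "v"], rule assms(2)) (auto intro!: derivative_eq_intros)
  have 3: "((\<lambda>z. \<sigma> (snd (fst (snd z)) / b - snd (fst z))) has_derivative
      (\<lambda>h. (snd (fst (snd h)) / b - snd (fst h)) * \<sigma>')) (at z)"
    by (rule DERIV_compose_FDERIV[where f = "\<sigma>"], rule assms(3)) (auto intro!: derivative_eq_intros simp: assms)
  have "(wrap b m c \<eta> v \<sigma> has_derivative L) (at z)"
    unfolding wrap_def[abs_def] L_def Let_def case_prod_beta
    by (auto intro!: derivative_eq_intros 1 2 3 simp: fun_eq_iff assms)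
  moreover have "omega (L u) (L v) = omega u v" for u v
    using assms(4,5) by (auto simp: omega_eq L_def Let_def case_prod_beta field_simps)
  ultimately show ?thesis
    unfolding symplectic_at_def by blast
qed

text \<open>The inverse scalings on the last factor preserve the form; \<open>l\<close> serves to
  balance the sizes of its two halves.\<close>

definition polar :: "real \<Rightarrow> 'k::finite pt \<Rightarrow> 'k pt" where
  "polar l z = (let (q, p) = fst z; (r, t) = fst (snd z) in
     ((sqrt (2 * q) * cos p, sqrt (2 * q) * sin p), (sqrt (2 * r) * cos t, sqrt (2 * r) * sin t),
      ((1 / l) *\<^sub>R fst (snd (snd z)), l *\<^sub>R snd (snd (snd z)))))"

text \<open>This is r dr dp = dq dp for q = r^2 / 2, evaluated on the tangent vectors (a, b) and (c,
  d).\<close>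

lemma polar_area:
  fixes q p :: real
  assumes "q > 0"
  defines "w \<equiv> sqrt (2 * q)"
  shows "(a / w * cos p - w * (b * sin p)) * (c / w * sin p + w * (d * cos p)) -
      (a / w * sin p + w * (b * cos p)) * (c / w * cos p - w * (d * sin p)) = a * d - b * c"
proof -
  have w: "w \<noteq> 0" using assms by simp
  have "(a / w * k - w * (b * s)) * (c / w * s + w * (d * k)) - (a / w * s + w * (b * k)) * (c / w * k - w * (d * s)) =
      (a * d - b * c) * (s\<^sup>2 + k\<^sup>2)" for s k :: real
    using w by (simp add: field_simps power2_eq_square)
  from this[of "cos p" "sin p"] show ?thesis by simp
qed

lemma symplectic_at_polar:
  assumes "fst (fst z) > 0" "fst (fst (snd z)) > 0" "l \<noteq> 0"
  shows "symplectic_at (polar l) z"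
proof -
  let ?w = "sqrt (2 * fst (fst z))" and ?w' = "sqrt (2 * fst (fst (snd z)))"
  let ?p = "snd (fst z)" and ?t = "snd (fst (snd z))"
  define L :: "'a pt \<Rightarrow> 'a pt" where
    "L h = ((fst (fst h) / ?w * cos ?p - ?w * (snd (fst h) * sin ?p), fst (fst h) / ?w * sin ?p + ?w * (snd (fst h) * cos ?p)),
       (fst (fst (snd h)) / ?w' * cos ?t - ?w' * (snd (fst (snd h)) * sin ?t),
        fst (fst (snd h)) / ?w' * sin ?t + ?w' * (snd (fst (snd h)) * cos ?t)),
      ((1 / l) *\<^sub>R fst (snd (snd h)), l *\<^sub>R snd (snd (snd h))))" for h
  have "(polar l has_derivative L) (at z)"
    unfolding polar_def[abs_def] L_def Let_def case_prod_beta
    using assms by (auto intro!: derivative_eq_intros simp: fun_eq_iff field_simps)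
  moreover have "omega (L u) (L v) = omega u v" for u v
    unfolding omega_eq L_def fst_conv snd_conv
    by (simp only: polar_area[OF assms(1)] polar_area[OF assms(2)]) (use assms(3) in simp)
  ultimately show ?thesis
    unfolding symplectic_at_def by blast
qed

section \<open>The immersed punctured torus\<close>

text \<open>For small \<open>a\<close> this is a smoothed square wave of period 1: it rises from 0
  to 1 during [0, a] and falls back during [1/2, 1/2 + a].\<close>

definition wave :: "real \<Rightarrow> real \<Rightarrow> real" where
  "wave a x = stair a x - stair a (x - 1/2)"

text \<open>The disc of area \<pi> becomes a rectangle of width \<open>amp a\<close> in q and height
  \<open>2 * pi * (1 - 6 * a)\<close> in p. The angle left out makes room for the flanks of the
  square wave, see \<open>ramp_eq_0\<close>.\<close>

definition amp :: "real \<Rightarrow> real" where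
  "amp a = 1 / (2 * (1 - 6 * a))"

text \<open>In units where the staircase has period 1 in \<open>u\<close>, the band is \<open>0 < frac u < a\<close>, and the loop at time \<open>u\<close> has
  angle \<open>4 \<pi> u\<close>. Around \<open>u = 0\<close> (the true crossing) the displacement \<open>ramp\<close> vanishes for all \<open>p\<close>; around \<open>u = 1/2\<close>
  (the spurious crossing) it is the full width \<open>amp a\<close> of the range of \<open>q\<close>. The loop is at \<open>level\<close> 0 for \<open>u\<close> in
  \<open>[0, 1/2 - a]\<close> and at \<open>level\<close> \<open>amp a\<close> for \<open>u\<close> in \<open>[-1/2, -a]\<close>. Leaving the square \<open>\<bar>x\<bar> \<le> S\<close> along the band, the
  angle starts to \<open>turn\<close>, by \<open>2 \<pi>\<close> for each period \<open>4 S\<close> of \<open>x\<close>.\<close>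

definition ramp :: "real \<Rightarrow> real \<Rightarrow> real" where
  "ramp a \<phi> = amp a * wave a (\<phi> / (4 * pi) - a)"

definition level :: "real \<Rightarrow> real \<Rightarrow> real \<Rightarrow> real" where
  "level a M u = amp a * (1 - wave a (u + a)) + 2 * M * stair a (u - 1/2 + a)"

definition turn :: "real \<Rightarrow> real \<Rightarrow> real" where
  "turn S x = 2 * pi * stair (1/2) ((x - S) / (4 * S))"

definition height :: "real \<Rightarrow> real \<Rightarrow> real \<Rightarrow> real \<Rightarrow> real \<Rightarrow> real \<Rightarrow> real" where
  "height a M S x u p = M / (4 * S) * x - M / (2 * pi) * (4 * pi * u + turn S x) + level a M u - ramp a (4 * pi * u - p)"

section \<open>The turning of the band\<close>

context
  fixes S :: real
  assumes S: "0 < S"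
begin

lemma turn_add_period: "turn S (x + 4 * S * of_int k) = turn S x + 2 * pi * of_int k"
  using S stair_add_int[of "1/2" "(x - S) / (4 * S)" k]
  by (simp add: turn_def add_divide_distrib diff_divide_distrib algebra_simps)

definition turn' :: "real \<Rightarrow> real" where
  "turn' x = 2 * pi * (stair' (1/2) ((x - S) / (4 * S)) / (4 * S))"

lemma turn_has_derivative: "(turn S has_real_derivative turn' x) (at x)"
proof -
  have d: "((\<lambda>x. (x - S) / (4 * S)) has_real_derivative 1 / (4 * S)) (at x)"
    using S by (auto intro!: derivative_eq_intros)
  show ?thesis
    unfolding turn_def[abs_def] turn'_def
    using DERIV_cmult[OF DERIV_chain2[OF stair_has_derivative[of "1/2"] d], of "2 * pi"] by simp
qed

lemma turn_eq_0:
  assumes "\<bar>x\<bar> \<le> S"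
  shows "turn S x = 0" "turn' x = 0"
proof -
  have "- 1/2 \<le> (x - S) / (4 * S)" "(x - S) / (4 * S) \<le> 0"
    using S assms by (auto simp: field_simps)
  then show "turn S x = 0" "turn' x = 0"
    using stair_flat[of "1/2" 0 "(x - S) / (4 * S)"] by (auto simp: turn_def turn'_def)
qed

text \<open>Together with \<open>turn_neg_imp\<close>, this turns the sign of an angle into the side
  of the strip \<open>\<bar>x\<bar> \<le> S\<close> on which a point lies.\<close>

lemma turn_pos_imp:
  assumes "0 < turn S x"
  shows "S < x"
proof (rule ccontr)
  assume "\<not> S < x"
  then have "(x - S) / (4 * S) \<le> 0"
    using S by (auto simp: field_simps)
  moreover have "stair (1/2) 0 = 0"
    using stair_flat(1)[of "1/2" 0 0] by simp
  moreover have "stair (1/2) y \<le> 0" if "y < 0" for y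
  proof -
    have "\<lfloor>y\<rfloor> \<le> -1" using that by linarith
    then show ?thesis using stair_bounds(2)[of "1/2" y] by linarith
  qed
  ultimately have "stair (1/2) ((x - S) / (4 * S)) \<le> 0"
    by (cases "(x - S) / (4 * S) = 0") (auto simp: less_le)
  with assms show False
    by (simp add: turn_def zero_less_mult_iff)
qed

lemma turn_neg_imp:
  assumes "turn S x < 0"
  shows "x < - S"
proof (rule ccontr)
  assume "\<not> x < - S"
  moreover have "turn S x \<ge> 0" if "x > S"
  proof -
    have "0 \<le> \<lfloor>(x - S) / (4 * S)\<rfloor>"
      using S that by (simp add: le_floor_iff)
    then have "0 \<le> stair (1/2) ((x - S) / (4 * S))"
      using stair_bounds(1)[of "(x - S) / (4 * S)" "1/2"] by (meson of_int_0_le_iff order_trans)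
    then show ?thesis by (simp add: turn_def)
  qed
  ultimately show False
    using turn_eq_0(1)[of x] assms by linarith
qed

end

section \<open>The square wave, the displacement and the levels\<close>

context
  fixes a :: real
  assumes a: "0 < a" "a \<le> 1/24"
begin

lemma frac_in_band:
  assumes "- 1/2 \<le> y" "y < 1/2"
  shows "0 < frac y \<and> frac y < a \<longleftrightarrow> 0 < y \<and> y < a"
proof (cases "y < 0")
  case True
  then have "\<lfloor>y\<rfloor> = -1" using assms by linarith
  then show ?thesis using assms a True by (auto simp: frac_def)
next
  case False
  then have "\<lfloor>y\<rfloor> = 0" using assms by linarith
  then show ?thesis by (simp add: frac_def)
qed

lemma amp_pos: "0 < amp a"
  using a by (simp add: amp_def)

lemma wave_bounds: "0 \<le> wave a x" "wave a x \<le> 1"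
proof -
  define n f where "n = \<lfloor>x\<rfloor>" and "f = frac x"
  have x: "x = of_int n + f" "0 \<le> f" "f < 1"
    by (auto simp: n_def f_def frac_def) linarith
  have "0 \<le> wave a x \<and> wave a x \<le> 1"
  proof (cases "f < 1/2")
    case True
    have "stair a (x - 1/2) = of_int n"
      by (rule stair_flat(1)) (use a x True in auto)
    moreover have "stair a x = of_int n + smooth_step (f / a)"
      by (simp add: stair_def n_def f_def)
    ultimately show ?thesis
      using smooth_step_bounds by (simp add: wave_def)
  next
    case False
    have "\<lfloor>x - 1/2\<rfloor> = n"
      using x False by linarith
    then have "of_int n \<le> stair a (x - 1/2)" "stair a (x - 1/2) \<le> of_int n + 1"
      using stair_bounds(1)[of "x - 1/2" a] stair_bounds(2)[of a "x - 1/2"] by auto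
    moreover have "stair a x = of_int (n + 1)"
      by (rule stair_flat(1)) (use a x False in auto)
    ultimately show ?thesis
      by (simp add: wave_def)
  qed
  then show "0 \<le> wave a x" "wave a x \<le> 1" by auto
qed

lemma wave_add_int: "wave a (x + of_int k) = wave a x"
  using stair_add_int[of a x k] stair_add_int[of a "x - 1/2" k] by (simp add: wave_def algebra_simps)

lemma wave_add_half: "wave a (x + 1/2) = 1 - wave a x"
  using stair_add_int[of a "x - 1/2" 1] by (simp add: wave_def add.commute)

lemma wave_has_derivative:
  "(wave a has_real_derivative stair' a x - stair' a (x - 1/2)) (at x)"
  unfolding wave_def[abs_def]
  by (rule derivative_intros stair_has_derivative DERIV_chain'[where g = "stair a" and E = "stair' a (x - 1/2)" and D = 1, simplified]
      | use a in \<open>auto intro!: derivative_eq_intros\<close>)+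

lemma wave_eq_0:
  assumes "- 1/2 + a \<le> x" "x \<le> 0"
  shows "wave a x = 0" "stair' a x - stair' a (x - 1/2) = 0"
  using stair_flat[of a 0 x] stair_flat[of a 0 "x - 1/2"] a assms by (auto simp: wave_def)

lemma ramp_bounds: "0 \<le> ramp a x" "ramp a x \<le> amp a"
  using amp_pos wave_bounds by (auto simp: ramp_def mult_le_cancel_left1 intro: mult_left_le)

lemma ramp_add_period: "ramp a (x + 4 * pi * of_int k) = ramp a x"
  using wave_add_int[of "x / (4 * pi) - a" k] by (simp add: ramp_def add_divide_distrib algebra_simps)

lemma ramp_add_half_period: "ramp a (x + 2 * pi) = amp a - ramp a x"
proof -
  have "(x + 2 * pi) / (4 * pi) - a = (x / (4 * pi) - a) + 1/2"
    by (simp add: field_simps)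
  then show ?thesis
    unfolding ramp_def by (simp only: wave_add_half) (simp add: algebra_simps)
qed

definition ramp' :: "real \<Rightarrow> real" where
  "ramp' x = amp a * ((stair' a (x / (4 * pi) - a) - stair' a (x / (4 * pi) - a - 1/2)) / (4 * pi))"

lemma ramp'_add_period: "ramp' (x + 4 * pi * of_int k) = ramp' x"
proof -
  have "(x + 4 * pi * of_int k) / (4 * pi) - a = (x / (4 * pi) - a) + of_int k"
    by (simp add: field_simps)
  moreover have "(x / (4 * pi) - a) + of_int k - 1/2 = (x / (4 * pi) - a - 1/2) + of_int k"
    by simp
  ultimately show ?thesis
    unfolding ramp'_def by (simp only: stair'_add_int)
qed

lemma ramp_has_derivative: "(ramp a has_real_derivative ramp' x) (at x)"
proof -
  have d: "((\<lambda>x. x / (4 * pi) - a) has_real_derivative 1 / (4 * pi)) (at x)"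
    by (auto intro!: derivative_eq_intros)
  show ?thesis
    unfolding ramp_def[abs_def] ramp'_def
    using DERIV_cmult[OF DERIV_chain2[OF wave_has_derivative d], of "amp a"] by simp
qed

text \<open>After division by 4\<pi>, u covers a length 2a and p a length 1/2 - 3a. Their sum 1/2 -
  a is exactly the length of a plateau of the wave, and the shift by \<open>a\<close> in
  \<open>ramp\<close> aligns the two. This fit explains the factor 1 - 6a.\<close>

lemma ramp_eq_0:
  assumes "- a \<le> u" "u \<le> a" "0 < p" "p < 2 * pi * (1 - 6 * a)"
  shows "ramp a (4 * pi * u - p) = 0" "ramp' (4 * pi * u - p) = 0"
proof -
  have "p / (4 * pi) < 1/2 - 3 * a"
    using assms by (simp add: field_simps)
  moreover have "p / (4 * pi) > 0"
    using assms pi_gt_zero by (intro divide_pos_pos) auto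
  moreover have "(4 * pi * u - p) / (4 * pi) - a = u - p / (4 * pi) - a"
    by (simp add: field_simps)
  moreover have "- 1/2 + a \<le> u - p / (4 * pi) - a" "u - p / (4 * pi) - a \<le> 0"
    using calculation assms a by linarith+
  ultimately show "ramp a (4 * pi * u - p) = 0" "ramp' (4 * pi * u - p) = 0"
    using wave_eq_0[of "u - p / (4 * pi) - a"] by (auto simp: ramp_def ramp'_def)
qed

lemma ramp_eq_amp:
  assumes "1/2 - a \<le> u" "u \<le> 1/2 + a" "0 < p" "p < 2 * pi * (1 - 6 * a)"
  shows "ramp a (4 * pi * u - p) = amp a"
  using ramp_eq_0(1)[of "u - 1/2" p] ramp_add_half_period[of "4 * pi * (u - 1/2) - p"] assms
  by (simp add: algebra_simps)

lemma level_add_int: "level a M (u + of_int k) = level a M u + 2 * M * of_int k"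
  using wave_add_int[of "u + a" k] stair_add_int[of a "u - 1/2 + a" k] by (simp add: level_def algebra_simps)

definition level' :: "real \<Rightarrow> real \<Rightarrow> real" where
  "level' M u = amp a * (stair' a (u + a - 1/2) - stair' a (u + a)) + 2 * M * stair' a (u - 1/2 + a)"

lemma level'_add_int: "level' M (u + of_int k) = level' M u"
  using stair'_add_int[of a "u + a" k] stair'_add_int[of a "u + a - 1/2" k] stair'_add_int[of a "u - 1/2 + a" k]
  by (simp add: level'_def algebra_simps)

lemma level_has_derivative: "(level a M has_real_derivative level' M u) (at u)"
proof -
  have d: "((\<lambda>u. u + a) has_real_derivative 1) (at u)" "((\<lambda>u. u - 1/2 + a) has_real_derivative 1) (at u)"
    by (auto intro!: derivative_eq_intros)
  have a1: "a < 1" using a by simp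
  show ?thesis
    unfolding level_def[abs_def] level'_def
    using DERIV_add[OF DERIV_cmult[OF DERIV_diff[OF DERIV_const DERIV_chain2[OF wave_has_derivative d(1)]], of "amp a" 1]
        DERIV_cmult[OF DERIV_chain2[OF stair_has_derivative[OF a(1) a1] d(2)], of "2 * M"]]
    by simp
qed

lemma level'_eq_0:
  assumes "0 \<le> u" "u \<le> a"
  shows "level' M u = 0"
  using stair_flat(2)[of a 1 "u + a"] stair_flat(2)[of a 0 "u + a - 1/2"] stair_flat(2)[of a 0 "u - 1/2 + a"] a assms
  by (simp add: level'_def)

lemma level_eq_0:
  assumes "0 \<le> u" "u \<le> 1/2 - a"
  shows "level a M u = 0"
  using stair_flat(1)[of a 1 "u + a"] stair_flat(1)[of a 0 "u + a - 1/2"] stair_flat(1)[of a 0 "u - 1/2 + a"] a assms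
  by (simp add: level_def wave_def)

lemma level_eq_amp:
  assumes "- 1/2 \<le> u" "u \<le> - a"
  shows "level a M u = amp a"
  using stair_flat(1)[of a 0 "u + a"] stair_flat(1)[of a 0 "u + a - 1/2"] stair_flat(1)[of a 0 "u - 1/2 + a"] a assms
  by (simp add: level_def wave_def)

lemma level_bounds:
  assumes "- 1/2 \<le> u" "u < 1/2" "0 < M"
  shows "0 \<le> level a M u" "level a M u \<le> amp a + 2 * M"
proof -
  have "\<lfloor>u - 1/2 + a\<rfloor> \<le> 0"
    using assms a by linarith
  then have 1: "stair a (u - 1/2 + a) \<le> 1"
    using stair_bounds(2)[of a "u - 1/2 + a"] by linarith
  have 2: "0 \<le> stair a (u - 1/2 + a)"
  proof (cases "u - 1/2 + a \<le> 0")
    case True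
    then show ?thesis
      using stair_flat(1)[of a 0 "u - 1/2 + a"] assms a by simp
  next
    case False
    then have "0 \<le> \<lfloor>u - 1/2 + a\<rfloor>" by linarith
    then have "(0::real) \<le> of_int \<lfloor>u - 1/2 + a\<rfloor>" by linarith
    then show ?thesis
      using stair_bounds(1)[of "u - 1/2 + a" a] by linarith
  qed
  have 3: "0 \<le> amp a * (1 - wave a (u + a))" "amp a * (1 - wave a (u + a)) \<le> amp a"
    using amp_pos wave_bounds[of "u + a"] by (auto intro: mult_left_le)
  have "2 * M * stair a (u - 1/2 + a) \<le> 2 * M * 1"
    by (rule mult_left_mono[OF 1]) (use assms in simp)
  moreover have "0 \<le> 2 * M * stair a (u - 1/2 + a)"
    using 2 assms by simp
  ultimately show "0 \<le> level a M u" "level a M u \<le> amp a + 2 * M"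
    unfolding level_def using 3 by linarith+
qed

section \<open>Excluding collisions, and the range of the height\<close>

context
  fixes S M :: real
  assumes S: "0 < S" and M: "0 < M"
begin

text \<open>A unit of u is two turns of the angle and lowers the height by 2M; the staircase in
  \<open>level\<close> gives the 2M back.\<close>

lemma height_add_int: "height a M S x (u + of_int k) p = height a M S x u p"
  using ramp_add_period[of "4 * pi * u - p" k] level_add_int[of M u k]
  by (simp add: height_def algebra_simps add_divide_distrib)

text \<open>The displacement on the loop is less than \<open>amp a\<close>, since q and q' lie in an
  interval of that length. For u > 0 the band point has x'' > S, so level minus ramp would be
  positive; but the level is 0 up to u = 1/2 - a, and beyond that the ramp has its excluded value
  \<open>amp a\<close>. For u \<le> 0 the signs are reversed: the level is \<open>amp a\<close> up
  to u = -a, and after that the ramp is 0.\<close>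

lemma no_collision_band_loop:
  assumes u: "- 1/2 \<le> u" "u < 1/2" "\<not> (0 < u \<and> u < a)" and x: "\<bar>x\<bar> < S" and u': "0 < u'" "u' < a"
    and p: "0 < p" "p < 2 * pi * (1 - 6 * a)" and q: "0 < q" "q < amp a" "0 < q'" "q' < amp a"
    and qs: "q + ramp a (4 * pi * u - p) = q' + ramp a (4 * pi * u' - p)"
    and h: "height a M S x u p = height a M S x' u' p"
    and ang: "4 * pi * u + turn S x = 4 * pi * u' + turn S x' + 2 * pi * of_int j"
  shows False
proof -
  let ?s = "ramp a (4 * pi * u - p)" and ?v = "level a M u"
  \<comment> \<open>Shifting x' by \<open>j\<close> periods of the band absorbs the \<open>j\<close>
    full turns, as \<open>turn\<close> then grows by the same angle.\<close>
  define x'' where "x'' = x' + 4 * S * of_int j"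
  have s': "ramp a (4 * pi * u' - p) = 0" and v': "level a M u' = 0"
    using ramp_eq_0(1)[of u' p] level_eq_0[of u' M] u' p a by auto
  have tx: "turn S x = 0" using turn_eq_0(1)[OF S] x by simp
  have t: "turn S x'' = 4 * pi * (u - u')"
    using ang tx turn_add_period[OF S, of x' j] by (simp add: x''_def algebra_simps)
  have s: "?s < amp a" "0 \<le> ?s"
    using qs s' q ramp_bounds[of "4 * pi * u - p"] by auto
  have "M / (2 * pi) * (4 * pi * u + turn S x) = M / (2 * pi) * (4 * pi * u' + turn S x') + M * of_int j"
    unfolding ang by (simp add: field_simps)
  moreover have "M / (4 * S) * x'' = M / (4 * S) * x' + M * of_int j"
    using S by (simp add: x''_def field_simps)
  ultimately have "M / (4 * S) * x + ?v - ?s = M / (4 * S) * x''"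
    using h by (simp add: height_def s' v')
  then have vs: "?v - ?s = M / (4 * S) * (x'' - x)"
    unfolding right_diff_distrib by linarith
  show False
  proof (cases "0 < u")
    case True
    then have "a \<le> u" using u by auto
    then have "0 < turn S x''" using t u' by simp
    then have "0 < x'' - x" using turn_pos_imp[OF S] x by force
    then have "0 < ?v - ?s" unfolding vs using M S by simp
    moreover have "?v = 0" if "u \<le> 1/2 - a" using level_eq_0 that True by simp
    moreover have "?s = amp a" if "u \<ge> 1/2 - a" using ramp_eq_amp that p u a by simp
    ultimately show False using s by linarith
  next
    case False
    then have "turn S x'' < 0" using t u' mult_pos_neg[of "4 * pi" "u - u'"] by simp
    then have "x'' - x < 0" using turn_neg_imp[OF S] x by force
    then have "?v - ?s < 0" unfolding vs using M S by (intro mult_pos_neg) auto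
    moreover have "?v = amp a" if "u \<le> - a" using level_eq_amp that u by simp
    moreover have "?s = 0" if "u \<ge> - a" using ramp_eq_0(1) that p False a by simp
    moreover have "0 \<le> ?v" using level_bounds(1) u M by simp
    ultimately show False using s by linarith
  qed
qed

text \<open>These are the two passages of the loop over one angle. For u \<le> -a, equal heights
  would require x-terms differing by at least M, while \<open>\<bar>x\<bar> < S\<close> allows less
  than M/2. For u closer to 0 the displacements are 0 and \<open>amp a\<close>, which no two values
  of q can compensate.\<close>

lemma no_collision_loop_loop:
  assumes u: "- 1/2 \<le> u" "u < 0" and x: "\<bar>x\<bar> < S" and x': "\<bar>x'\<bar> < S"
    and p: "0 < p" "p < 2 * pi * (1 - 6 * a)" and q: "0 < q" "q < amp a" "0 < q'" "q' < amp a"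
    and qs: "q + ramp a (4 * pi * u - p) = q' + ramp a (4 * pi * (u + 1/2) - p)"
    and h: "height a M S x u p = height a M S x' (u + 1/2) p"
  shows False
proof -
  let ?s = "ramp a (4 * pi * u - p)"
  have s': "ramp a (4 * pi * (u + 1/2) - p) = amp a - ?s"
    using ramp_add_half_period[of "4 * pi * u - p"] by (simp add: algebra_simps)
  show False
  proof (cases "u \<le> - a")
    case True
    have "level a M u = amp a" "level a M (u + 1/2) = 0"
      using level_eq_amp[of u M] level_eq_0[of "u + 1/2" M] True u by auto
    moreover have "turn S x = 0" "turn S x' = 0"
      using turn_eq_0(1)[OF S] x x' by auto
    ultimately have "M / (4 * S) * (x' - x) = M + 2 * (amp a - ?s)"
      using h unfolding height_def s' by (simp add: algebra_simps add_divide_distrib diff_divide_distrib)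
    moreover have "M / (4 * S) * (x' - x) < M / (4 * S) * (2 * S)"
      by (rule mult_strict_left_mono) (use x x' M S in auto)
    ultimately show False
      using ramp_bounds[of "4 * pi * u - p"] M S by simp
  next
    case False
    then have "?s = 0" using ramp_eq_0(1)[of u p] u p a by simp
    then show False using qs s' q by simp
  qed
qed

lemma wrap_injective:
  assumes loc: "(0 < frac u \<and> frac u < a) \<or> \<bar>x\<bar> < S" and loc': "(0 < frac u' \<and> frac u' < a) \<or> \<bar>x'\<bar> < S"
    and p: "0 < p" "p < 2 * pi * (1 - 6 * a)" and q: "0 < q" "q < amp a" "0 < q'" "q' < amp a"
    and qs: "q + ramp a (4 * pi * u - p) = q' + ramp a (4 * pi * u' - p)"
    and h: "height a M S x u p = height a M S x' u' p"
    and ang: "4 * pi * u + turn S x = 4 * pi * u' + turn S x' + 2 * pi * of_int j"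
  shows "\<exists>k. u = u' + of_int k"
proof -
  define n n' where "n = \<lfloor>u + 1/2\<rfloor>" and "n' = \<lfloor>u' + 1/2\<rfloor>"
  define w w' where "w = u - of_int n" and "w' = u' - of_int n'"
  have w: "- 1/2 \<le> w" "w < 1/2" and w': "- 1/2 \<le> w'" "w' < 1/2"
    by (auto simp: w_def w'_def n_def n'_def) linarith+
  have fr: "frac u = frac w" "frac u' = frac w'"
    by (auto simp: w_def w'_def frac_def)
  have u: "u = w + of_int n" and u': "u' = w' + of_int n'"
    by (simp_all add: w_def w'_def)
  have ramp_u: "ramp a (4 * pi * u - p) = ramp a (4 * pi * w - p)"
    "ramp a (4 * pi * u' - p) = ramp a (4 * pi * w' - p)"
    using ramp_add_period[of "4 * pi * w - p" n] ramp_add_period[of "4 * pi * w' - p" n']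
    by (simp_all add: u u' algebra_simps)
  have qs: "q + ramp a (4 * pi * w - p) = q' + ramp a (4 * pi * w' - p)"
    using qs ramp_u by simp
  have h: "height a M S x w p = height a M S x' w' p"
    using h by (simp add: u u' height_add_int)
  \<comment> \<open>Each unit of u accounts for two turns of angle.\<close>
  define i where "i = j + 2 * n' - 2 * n"
  have ang: "4 * pi * w + turn S x = 4 * pi * w' + turn S x' + 2 * pi * of_int i"
    using ang by (simp add: u u' i_def algebra_simps)
  have ang': "4 * pi * w' + turn S x' = 4 * pi * w + turn S x + 2 * pi * of_int (- i)"
    using ang by simp
  have "w = w'"
  proof (cases "0 < w \<and> w < a"; cases "0 < w' \<and> w' < a")
    \<comment> \<open>Two band points: ramp and level vanish, so equal height and angle force x and
      x' to differ by \<open>i\<close> periods. The turning then accounts for all \<open>i\<close>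
      turns.\<close>
    assume good: "0 < w \<and> w < a" "0 < w' \<and> w' < a"
    have "ramp a (4 * pi * w - p) = 0" "ramp a (4 * pi * w' - p) = 0" "level a M w = 0" "level a M w' = 0"
      using ramp_eq_0(1)[of w p] ramp_eq_0(1)[of w' p] level_eq_0[of w M] level_eq_0[of w' M] good p a by auto
    then have "M / (4 * S) * x - M / (2 * pi) * (4 * pi * w + turn S x) =
        M / (4 * S) * x' - M / (2 * pi) * (4 * pi * w' + turn S x')"
      using h by (simp add: height_def)
    moreover have "M / (2 * pi) * (4 * pi * w + turn S x) = M / (2 * pi) * (4 * pi * w' + turn S x') + M * of_int i"
      unfolding ang by (simp add: field_simps)
    ultimately have "M / (4 * S) * x = M / (4 * S) * x' + M * of_int i"
      by simp
    then have "M * x = M * (x' + 4 * S * of_int i)"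
      using S by (simp add: field_simps)
    then have "x = x' + 4 * S * of_int i"
      using M by simp
    then have "turn S x = turn S x' + 2 * pi * of_int i"
      using turn_add_period[OF S] by simp
    then show ?thesis using ang by simp
  next
    assume good: "0 < w \<and> w < a" "\<not> (0 < w' \<and> w' < a)"
    then have "\<bar>x'\<bar> < S" using loc' fr frac_in_band w' by auto
    then show ?thesis
      using no_collision_band_loop[OF w' good(2) _ _ _ p q(3,4,1,2) qs[symmetric] h[symmetric] ang'] good by blast
  next
    assume good: "\<not> (0 < w \<and> w < a)" "0 < w' \<and> w' < a"
    then have "\<bar>x\<bar> < S" using loc fr frac_in_band w by auto
    then show ?thesis
      using no_collision_band_loop[OF w good(1) _ _ _ p q qs h ang] good by blast
  next
    \<comment> \<open>Two loop points: nothing turns and the angle is 4\<pi>w, so w and w' agree or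
      differ by 1/2.\<close>
    assume good: "\<not> (0 < w \<and> w < a)" "\<not> (0 < w' \<and> w' < a)"
    then have x: "\<bar>x\<bar> < S" "\<bar>x'\<bar> < S" using loc loc' fr frac_in_band w w' by auto
    then have "4 * pi * (w - w') = 2 * pi * of_int i"
      using ang turn_eq_0(1)[OF S, of x] turn_eq_0(1)[OF S, of x'] by (simp add: algebra_simps)
    then have "2 * pi * (2 * (w - w')) = 2 * pi * of_int i"
      by linarith
    then have i: "2 * (w - w') = of_int i"
      by simp
    have "2 * (w - w') < 2" "- 2 < 2 * (w - w')" using w w' by auto
    then have "i < 2" "- 2 < i" unfolding i by linarith+
    then have "i = 0 \<or> i = 1 \<or> i = -1" by linarith
    then consider "w = w'" | "w = w' + 1/2" | "w' = w + 1/2"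
      using i by fastforce
    then show ?thesis
    proof cases
      case 2
      then show ?thesis
        using no_collision_loop_loop[of w' x' x p q' q] w w' x p q qs h by auto
    next
      case 3
      then show ?thesis
        using no_collision_loop_loop[of w x x' p q q'] w w' x p q qs h by auto
    qed
  qed
  then show ?thesis
    by (intro exI[of _ "n - n'"]) (simp add: u u')
qed

text \<open>The constant 13/4 comes from the loop: x contributes less than M/4, the angle at most M,
  and the level at most \<open>amp a + 2 * M\<close>. On the band, x is first reduced modulo its
  period.\<close>

lemma height_bounds:
  assumes loc: "(0 < frac u \<and> frac u < a) \<or> \<bar>x\<bar> < S" and p: "0 < p" "p < 2 * pi * (1 - 6 * a)"
  shows "0 < amp a + 2 * M + height a M S x u p"
    and "height a M S x u p + ramp a (4 * pi * u - p) < amp a + 13/4 * M"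
proof -
  define n where "n = \<lfloor>u + 1/2\<rfloor>"
  define w where "w = u - of_int n"
  have w: "- 1/2 \<le> w" "w < 1/2"
    by (auto simp: w_def n_def) linarith+
  have u: "u = w + of_int n"
    by (simp add: w_def)
  have "frac u = frac w"
    by (simp add: w_def frac_def)
  then have loc: "(0 < w \<and> w < a) \<or> \<bar>x\<bar> < S"
    using loc frac_in_band[OF w] by auto
  have hu: "height a M S x u p = height a M S x w p"
    by (simp add: u height_add_int)
  have ru: "ramp a (4 * pi * u - p) = ramp a (4 * pi * w - p)"
    using ramp_add_period[of "4 * pi * w - p" n] by (simp add: u algebra_simps)
  have height_w: "height a M S x w p = (M / (4 * S) * x - M / (2 * pi) * turn S x) - 2 * (M * w) + level a M w - ramp a (4 * pi * w - p)"
    by (simp add: height_def field_simps)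
  have "0 < amp a + 2 * M + height a M S x w p \<and> height a M S x w p + ramp a (4 * pi * w - p) < amp a + 13/4 * M"
  proof (cases "\<bar>x\<bar> < S")
    case True
    have "M / (2 * pi) * turn S x = 0" using turn_eq_0(1)[OF S] True by simp
    moreover have "M / (4 * S) * x < M / (4 * S) * S" "M / (4 * S) * (- S) < M / (4 * S) * x"
      by (rule mult_strict_left_mono; use True M S in auto)+
    moreover have "M / (4 * S) * S = M / 4" "M / (4 * S) * (- S) = - M / 4"
      using S by auto
    moreover have "M * w \<le> M * (1/2)" "M * (- 1/2) \<le> M * w"
      by (rule mult_left_mono; use w M in auto)+
    ultimately show ?thesis
      using level_bounds[OF w M] ramp_bounds[of "4 * pi * w - p"] M unfolding height_w by (intro conjI; linarith)
  next
    case False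
    then have good: "0 < w" "w < a" using loc by auto
    \<comment> \<open>The combination of the linear term and the turning is invariant under x to x +
      4S: both change by M.\<close>
    define k where "k = \<lfloor>(x + S) / (4 * S)\<rfloor>"
    define y where "y = x - 4 * S * of_int k"
    have "of_int k \<le> (x + S) / (4 * S)" "(x + S) / (4 * S) < of_int k + 1"
      by (auto simp: k_def)
    then have y: "- S \<le> y" "y < 3 * S"
      using S by (auto simp: y_def field_simps)
    have "turn S x = turn S y + 2 * pi * of_int k"
      using turn_add_period[OF S, of y k] by (simp add: y_def)
    then have xy: "M / (4 * S) * x - M / (2 * pi) * turn S x = M / (4 * S) * y - M / (2 * pi) * turn S y"
      using S by (simp add: y_def field_simps)
    have t: "0 \<le> turn S y" "turn S y \<le> 2 * pi"
    proof -
      show "0 \<le> turn S y"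
        using turn_neg_imp[OF S, of y] y by linarith
      have "\<lfloor>(y - S) / (4 * S)\<rfloor> \<le> 0"
        using y S by (simp add: floor_le_iff field_simps)
      then have "stair (1/2) ((y - S) / (4 * S)) \<le> 1"
        using stair_bounds(2)[of "1/2" "(y - S) / (4 * S)"] by linarith
      then show "turn S y \<le> 2 * pi"
        by (simp add: turn_def)
    qed
    have "0 \<le> M / (2 * pi) * turn S y" "M / (2 * pi) * turn S y \<le> M / (2 * pi) * (2 * pi)"
      using t M by (auto intro!: mult_left_mono simp del: times_divide_eq_left nonzero_mult_div_cancel_right)
    moreover have "M / (4 * S) * y < M / (4 * S) * (3 * S)" "M / (4 * S) * (- S) \<le> M / (4 * S) * y"
      by (rule mult_strict_left_mono mult_left_mono; use y M S in auto)+
    moreover have "M / (4 * S) * (3 * S) = 3/4 * M" "M / (4 * S) * (- S) = - M/4" "M / (2 * pi) * (2 * pi) = M"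
      using S by auto
    moreover have "0 \<le> M * w" "M * w \<le> M * (1/24)"
      using good a M by (auto intro!: mult_left_mono)
    moreover have "level a M w = 0" "ramp a (4 * pi * w - p) = 0"
      using ramp_eq_0(1)[of w p] level_eq_0[of w M] good p a by auto
    ultimately show ?thesis
      using amp_pos M unfolding height_w xy by (intro conjI; linarith)
  qed
  then show "0 < amp a + 2 * M + height a M S x u p"
    "height a M S x u p + ramp a (4 * pi * u - p) < amp a + 13/4 * M"
    using hu ru by auto
qed

end
end

section \<open>The embedding\<close>

lemma polar_coordinates_eq:
  fixes q q' p p' :: real
  assumes "sqrt (2 * q) * cos p = sqrt (2 * q') * cos p'" "sqrt (2 * q) * sin p = sqrt (2 * q') * sin p'"
    and "0 < q" "0 < q'"
  shows "q = q'" "\<exists>j::int. p = p' + 2 * pi * of_int j"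
proof -
  have *: "(sqrt (2 * r) * cos t)\<^sup>2 + (sqrt (2 * r) * sin t)\<^sup>2 = 2 * r" if "0 < r" for r t :: real
    using that by (simp add: power_mult_distrib distrib_left[symmetric])
  show q: "q = q'"
    using *[OF assms(3), of p] *[OF assms(4), of p'] assms(1,2) by simp
  have "sin p = sin p' \<and> cos p = cos p'"
    using assms q by simp
  then show "\<exists>j::int. p = p' + 2 * pi * of_int j"
    by (simp add: sin_cos_eq_iff)
qed

text \<open>The factor S / (\<pi>M) rescales y_1 to u, so that y_1 divided by M / (4S) is 4\<pi>u.
  The periods 4S in x_1 and \<pi>M / S in y_1 span a lattice of area 4\<pi>M. The offset
  \<open>amp a + 2 * M\<close> keeps the second action positive.\<close>

definition embedding :: "'k::finite \<Rightarrow> real \<Rightarrow> real \<Rightarrow> real \<Rightarrow> real \<Rightarrow> 'k pt \<Rightarrow> 'k pt" where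
  "embedding i a M S l z =
     polar l (wrap (M / (4 * S)) (M / (2 * pi)) (amp a + 2 * M) (turn S) (\<lambda>y. level a M (y * (S / (pi * M)))) (ramp a)
       (shear i (\<lambda>y. 2 * S * stair a (y * (S / (pi * M)))) (\<lambda>y. 2 * S * (stair' a (y * (S / (pi * M))) * (S / (pi * M))))
         (rectify (amp a / 2) (\<lambda>y. 4 * (1 - 6 * a) * sqrt (1 - y\<^sup>2)) (\<lambda>y. 2 * pi * (1 - 6 * a) * disc_area y) z)))"

definition coord_q :: "real \<Rightarrow> 'k::finite pt \<Rightarrow> real" where
  "coord_q a z = amp a / 2 + fst (fst z) / (4 * (1 - 6 * a) * sqrt (1 - (snd (fst z))\<^sup>2))"

definition coord_p :: "real \<Rightarrow> 'k::finite pt \<Rightarrow> real" where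
  "coord_p a z = 2 * pi * (1 - 6 * a) * disc_area (snd (fst z))"

definition coord_u :: "real \<Rightarrow> real \<Rightarrow> 'k::finite pt \<Rightarrow> real" where
  "coord_u M S z = snd (fst (snd z)) * (S / (pi * M))"

definition coord_x :: "'k::finite \<Rightarrow> real \<Rightarrow> real \<Rightarrow> real \<Rightarrow> 'k pt \<Rightarrow> real" where
  "coord_x i a M S z = fst (fst (snd z)) + 2 * S * (stair' a (coord_u M S z) * (S / (pi * M))) * snd (snd (snd z)) $ i"

definition action1 :: "real \<Rightarrow> real \<Rightarrow> real \<Rightarrow> 'k::finite pt \<Rightarrow> real" where
  "action1 a M S z = coord_q a z + ramp a (4 * pi * coord_u M S z - coord_p a z)"

definition action2 :: "'k::finite \<Rightarrow> real \<Rightarrow> real \<Rightarrow> real \<Rightarrow> 'k pt \<Rightarrow> real" where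
  "action2 i a M S z = amp a + 2 * M + height a M S (coord_x i a M S z) (coord_u M S z) (coord_p a z)"

definition angle2 :: "'k::finite \<Rightarrow> real \<Rightarrow> real \<Rightarrow> real \<Rightarrow> 'k pt \<Rightarrow> real" where
  "angle2 i a M S z = 4 * pi * coord_u M S z + turn S (coord_x i a M S z)"

text \<open>Injectivity, joint smoothness and the size of the image are all read off from this
  closed form.\<close>

lemma embedding_eq:
  assumes "0 < M" "0 < S"
  shows "embedding i a M S l z =
    ((sqrt (2 * action1 a M S z) * cos (coord_p a z), sqrt (2 * action1 a M S z) * sin (coord_p a z)),
     (sqrt (2 * action2 i a M S z) * cos (angle2 i a M S z), sqrt (2 * action2 i a M S z) * sin (angle2 i a M S z)),
     ((1 / l) *\<^sub>R (fst (snd (snd z)) + (2 * S * stair a (coord_u M S z)) *\<^sub>R axis i 1), l *\<^sub>R snd (snd (snd z))))"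
proof -
  have u: "y / (M / (4 * S)) = 4 * pi * (y * (S / (pi * M)))" for y
    using assms by (simp add: field_simps)
  show ?thesis
    unfolding embedding_def polar_def wrap_def shear_def rectify_def Let_def case_prod_beta fst_conv snd_conv u
      action1_def action2_def angle2_def height_def coord_q_def coord_p_def coord_x_def coord_u_def
    by (simp add: algebra_simps)
qed

lemma source_set_bounds:
  assumes "z \<in> source_set S"
  shows "\<bar>snd (fst z)\<bar> < 1" "\<bar>fst (fst z)\<bar> < sqrt (1 - (snd (fst z))\<^sup>2)" "\<bar>fst (fst (snd z))\<bar> < S" "\<bar>snd (fst (snd z))\<bar> < S"
    "norm (fst (snd (snd z))) < S" "norm (snd (snd (snd z))) < S"
proof -
  have 1: "norm (fst z) < 1" and 2: "norm (snd z) < S"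
    using assms by (auto simp: source_set_def)
  have *: "(fst (fst z))\<^sup>2 + (snd (fst z))\<^sup>2 < 1"
    using 1 by (simp add: norm_prod_def)
  then have "(snd (fst z))\<^sup>2 < 1"
    using zero_le_power2[of "fst (fst z)"] by linarith
  then show "\<bar>snd (fst z)\<bar> < 1"
    by (simp add: abs_square_less_1)
  show "\<bar>fst (fst z)\<bar> < sqrt (1 - (snd (fst z))\<^sup>2)"
    using * by (intro real_less_rsqrt) simp
  have "norm (fst (snd z)) < S" "norm (snd (snd z)) < S"
    using 2 norm_fst_le[of "fst (snd z)" "snd (snd z)"] norm_snd_le[of "snd (snd z)" "fst (snd z)"] by auto
  then show "\<bar>fst (fst (snd z))\<bar> < S" "\<bar>snd (fst (snd z))\<bar> < S" "norm (fst (snd (snd z))) < S" "norm (snd (snd (snd z))) < S"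
    using norm_fst_le[of "fst (fst (snd z))" "snd (fst (snd z))"] norm_snd_le[of "snd (fst (snd z))" "fst (fst (snd z))"]
      norm_fst_le[of "fst (snd (snd z))" "snd (snd (snd z))"] norm_snd_le[of "snd (snd (snd z))" "fst (snd (snd z))"] by auto
qed

section \<open>The embedding for fixed parameters\<close>

context
  fixes a M S :: real and i :: "'k::finite"
  assumes a: "0 < a" "a \<le> 1/24" and M: "0 < M" and S: "0 < S"
begin

lemma coordinate_bounds:
  assumes "z \<in> source_set S"
  shows "0 < coord_q a z" "coord_q a z < amp a" "0 < coord_p a z" "coord_p a z < 2 * pi * (1 - 6 * a)"
proof -
  let ?y = "snd (fst z)" and ?x = "fst (fst z)"
  have a6: "0 < 1 - 6 * a" using a by simp
  note b = source_set_bounds[OF assms]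
  then have r: "0 < sqrt (1 - ?y\<^sup>2)" by linarith
  have "\<bar>?x / (4 * (1 - 6 * a) * sqrt (1 - ?y\<^sup>2))\<bar> = (\<bar>?x\<bar> / sqrt (1 - ?y\<^sup>2)) / (4 * (1 - 6 * a))"
    using a6 r by (simp add: abs_mult)
  also have "\<dots> < 1 / (4 * (1 - 6 * a))"
    using a6 r b(2) by (intro divide_strict_right_mono) auto
  also have "\<dots> = amp a / 2" by (simp add: amp_def)
  finally show "0 < coord_q a z" "coord_q a z < amp a"
    unfolding coord_q_def abs_less_iff by linarith+
  show "0 < coord_p a z" "coord_p a z < 2 * pi * (1 - 6 * a)"
    using disc_area_bounds[OF b(1)] a6 by (auto simp: coord_p_def)
qed

text \<open>Off the rises of the staircase the shear leaves x_1 unchanged, and x_1 starts with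
  absolute value below S.\<close>

lemma band_or_loop:
  assumes "z \<in> source_set S"
  shows "(0 < frac (coord_u M S z) \<and> frac (coord_u M S z) < a) \<or> \<bar>coord_x i a M S z\<bar> < S"
proof (rule disjCI)
  assume "\<not> \<bar>coord_x i a M S z\<bar> < S"
  then have "stair' a (coord_u M S z) \<noteq> 0"
    using source_set_bounds(3)[OF assms] unfolding coord_x_def by auto
  then show "0 < frac (coord_u M S z) \<and> frac (coord_u M S z) < a"
    using stair'_eq_0[OF a(1)] by blast
qed

text \<open>The ramp cancels in the sum of the two actions. What remains contains
  \<open>amp a\<close> three times: from the range of q, from the offset and from the level.\<close>

lemma action_bounds:
  assumes z: "z \<in> source_set S"
  shows "0 < action1 a M S z" "0 < action2 i a M S z"
    "2 * action1 a M S z + 2 * action2 i a M S z < 6 * amp a + 21/2 * M"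
proof -
  note c = coordinate_bounds[OF z]
  note h = height_bounds[OF a S M band_or_loop[OF z] c(3,4)]
  show "0 < action1 a M S z"
    using c(1) ramp_bounds(1)[OF a] by (simp add: action1_def add_pos_nonneg)
  show "0 < action2 i a M S z"
    using h(1) by (simp add: action2_def)
  show "2 * action1 a M S z + 2 * action2 i a M S z < 6 * amp a + 21/2 * M"
  proof -
    have "2 * (q + r) + 2 * (A + 2 * M + h) < 6 * A + 21/2 * M" if "h + r < A + 13/4 * M" "q < A" for q r A h
      using that by (simp add: field_simps)
    from this[OF h(2) c(2)] show ?thesis
      unfolding action1_def action2_def .
  qed
qed

lemma inj_on_embedding:
  assumes "l \<noteq> 0"
  shows "inj_on (embedding i a M S l) (source_set S)"
proof (rule inj_onI)
  fix z z' :: "'k pt"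
  assume z: "z \<in> source_set S" and z': "z' \<in> source_set S" and eq: "embedding i a M S l z = embedding i a M S l z'"
  note b = source_set_bounds[OF z] and b' = source_set_bounds[OF z']
  note c = coordinate_bounds[OF z] and c' = coordinate_bounds[OF z']
  note E = eq[unfolded embedding_eq[OF M S] prod.inject]
  let ?u = "coord_u M S z" and ?u' = "coord_u M S z'"
  have y: "snd (snd (snd z)) = snd (snd (snd z'))"
    and x: "fst (snd (snd z)) + (2 * S * stair a ?u) *\<^sub>R axis i 1 = fst (snd (snd z')) + (2 * S * stair a ?u') *\<^sub>R axis i 1"
    using E assms by auto
  have A1: "action1 a M S z = action1 a M S z'" and "\<exists>j::int. coord_p a z = coord_p a z' + 2 * pi * of_int j"
    using polar_coordinates_eq[OF _ _ action_bounds(1)[OF z] action_bounds(1)[OF z']] E by auto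
  then obtain j where j: "coord_p a z = coord_p a z' + 2 * pi * of_int j" by blast
  \<comment> \<open>The range of p is shorter than a full turn.\<close>
  have "2 * pi * (1 - 6 * a) < 2 * pi" using a by simp
  then have "2 * pi * of_int j < 2 * pi * 1" "2 * pi * (- 1) < 2 * pi * of_int j"
    using j c(3,4) c'(3,4) by linarith+
  then have "real_of_int j < 1" "- 1 < real_of_int j"
    using mult_less_cancel_left_pos[of "2 * pi"] by (simp_all only: pi_gt_zero mult_pos_pos zero_less_numeral)
  then have "j = 0" by linarith
  then have p: "coord_p a z = coord_p a z'" using j by simp
  have A2: "action2 i a M S z = action2 i a M S z'" and "\<exists>k::int. angle2 i a M S z = angle2 i a M S z' + 2 * pi * of_int k"
    using polar_coordinates_eq[OF _ _ action_bounds(2)[OF z] action_bounds(2)[OF z']] E by auto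
  then obtain k where k: "angle2 i a M S z = angle2 i a M S z' + 2 * pi * of_int k" by blast
  have "\<exists>n. ?u = ?u' + of_int n"
    by (rule wrap_injective[OF a S M band_or_loop[OF z] band_or_loop[OF z'] c(3,4,1,2) c'(1,2)])
      (use A1 A2 k p in \<open>auto simp: action1_def action2_def angle2_def\<close>)
  then obtain n where n: "?u = ?u' + of_int n" by blast
  \<comment> \<open>A collision modulo the lattice is resolved here: each unit of u shifts component
    \<open>i\<close> by 2S, which is the width of its original range.\<close>
  have "fst (snd (snd z')) $ i - fst (snd (snd z)) $ i = 2 * S * of_int n"
    using arg_cong[OF x, of "\<lambda>v. v $ i"] stair_add_int[of a ?u' n] by (simp add: n algebra_simps axis_def)
  moreover have "\<bar>fst (snd (snd z)) $ i\<bar> < S" "\<bar>fst (snd (snd z')) $ i\<bar> < S"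
    using component_le_norm_cart[of "fst (snd (snd z))" i] component_le_norm_cart[of "fst (snd (snd z'))" i] b(5) b'(5)
    by linarith+
  ultimately have "\<bar>2 * S * of_int n\<bar> < 2 * S * 1" by linarith
  then have "n = 0" using S by (simp add: abs_mult)
  then have u: "?u = ?u'" using n by simp
  have xs: "fst (snd (snd z)) = fst (snd (snd z'))" using x u by simp
  have q: "coord_q a z = coord_q a z'" using A1 u p by (simp add: action1_def)
  have y1: "snd (fst (snd z)) = snd (fst (snd z'))"
    using u M S by (simp add: coord_u_def)
  let ?x = "coord_x i a M S z" and ?x' = "coord_x i a M S z'"
  \<comment> \<open>Now only whole periods 4S of x are in question. The shear moves both points
    equally, so the difference of x is that of the original x_1, which is less than 2S.\<close>
  have "M / (4 * S) * ?x - M / (2 * pi) * angle2 i a M S z = M / (4 * S) * ?x' - M / (2 * pi) * angle2 i a M S z'"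
    using A2 u p by (simp add: action2_def height_def angle2_def)
  moreover have "M / (2 * pi) * angle2 i a M S z = M / (2 * pi) * angle2 i a M S z' + M * of_int k"
    unfolding k by (simp add: field_simps)
  ultimately have "M / (4 * S) * ?x = M / (4 * S) * ?x' + M * of_int k"
    by linarith
  then have "M * (?x - ?x') = M * (4 * S * of_int k)"
    using S by (simp add: field_simps)
  then have "?x - ?x' = 4 * S * of_int k" using M by simp
  moreover have "?x - ?x' = fst (fst (snd z)) - fst (fst (snd z'))"
    using u y by (simp add: coord_x_def)
  ultimately have "\<bar>4 * S * of_int k\<bar> < 4 * S * 1"
    using b(3) b'(3) by linarith
  then have "k = 0" using S by (simp add: abs_mult)
  then have x1: "fst (fst (snd z)) = fst (fst (snd z'))"
    using \<open>?x - ?x' = 4 * S * of_int k\<close> \<open>?x - ?x' = fst (fst (snd z)) - fst (fst (snd z'))\<close> by simp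
  have "disc_area (snd (fst z)) = disc_area (snd (fst z'))"
    using p a by (simp add: coord_p_def)
  then have y0: "snd (fst z) = snd (fst z')"
    using disc_area_strict_mono[of "snd (fst z)" "snd (fst z')"] disc_area_strict_mono[of "snd (fst z')" "snd (fst z)"] b(1) b'(1)
    by (cases "snd (fst z)" "snd (fst z')" rule: linorder_cases) (auto simp: abs_less_iff)
  have "0 < sqrt (1 - (snd (fst z'))\<^sup>2)" using b'(2) by linarith
  then have x0: "fst (fst z) = fst (fst z')"
    using q a by (simp add: coord_q_def y0)
  show "z = z'"
    using x0 y0 x1 y1 xs y by (simp add: prod_eq_iff)
qed

lemma symplectic_at_embedding:
  assumes z: "z \<in> source_set S" and l: "l \<noteq> 0"
  shows "symplectic_at (embedding i a M S l) z"
proof -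
  note c = coordinate_bounds[OF z] and b = source_set_bounds[OF z]
  have a1: "a < 1" and a6: "0 < 1 - 6 * a" using a by auto
  let ?k = "S / (pi * M)"
  let ?R = "rectify (amp a / 2) (\<lambda>y. 4 * (1 - 6 * a) * sqrt (1 - y\<^sup>2)) (\<lambda>y. 2 * pi * (1 - 6 * a) * disc_area y) :: 'k pt \<Rightarrow> 'k pt"
  let ?g = "\<lambda>y. 2 * S * stair a (y * ?k)" and ?g' = "\<lambda>y. 2 * S * (stair' a (y * ?k) * ?k)"
  let ?v = "\<lambda>y. level a M (y * ?k)"
  let ?W = "wrap (M / (4 * S)) (M / (2 * pi)) (amp a + 2 * M) (turn S) ?v (ramp a) :: 'k pt \<Rightarrow> 'k pt"
  define z1 where "z1 = ?R z"
  define z2 where "z2 = shear i ?g ?g' z1"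
  define z3 where "z3 = ?W z2"
  have r: "0 < sqrt (1 - (snd (fst z))\<^sup>2)" using b(2) by linarith
  then have r2: "(snd (fst z))\<^sup>2 < 1" by simp
  have lin: "((\<lambda>y. y * ?k) has_real_derivative ?k) (at y)" for y
    using M by (auto intro!: derivative_eq_intros)
  have 1: "symplectic_at ?R z"
  proof (rule symplectic_at_rectify)
    show "((\<lambda>y. 4 * (1 - 6 * a) * sqrt (1 - y\<^sup>2)) has_real_derivative
        4 * (1 - 6 * a) * (- snd (fst z) / sqrt (1 - (snd (fst z))\<^sup>2))) (at (snd (fst z)))"
      using r2 by (auto intro!: derivative_eq_intros simp: field_simps)
    show "((\<lambda>y. 2 * pi * (1 - 6 * a) * disc_area y) has_real_derivative 4 * (1 - 6 * a) * sqrt (1 - (snd (fst z))\<^sup>2)) (at (snd (fst z)))"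
      by (rule DERIV_cong[OF DERIV_cmult[OF disc_area_has_derivative[OF b(1)]]]) simp
  qed (use r a6 in auto)
  have 2: "symplectic_at (shear i ?g ?g') z1"
  proof -
    obtain d where d: "(stair' a has_real_derivative d) (at (snd (fst (snd z1)) * ?k))"
      using stair'_has_derivative[OF a(1) a1] by blast
    show ?thesis
    proof (rule symplectic_at_shear)
      show "(?g has_real_derivative ?g' (snd (fst (snd z1)))) (at (snd (fst (snd z1))))"
        by (rule DERIV_cmult[OF DERIV_chain2[OF stair_has_derivative[OF a(1) a1] lin]])
      show "(?g' has_real_derivative 2 * S * (d * ?k * ?k)) (at (snd (fst (snd z1))))"
        by (rule DERIV_cmult[OF DERIV_cmult_right[OF DERIV_chain2[OF d lin]]])
    qed
  qed
  have z2: "snd (fst (snd z2)) * ?k = coord_u M S z" "snd (fst z2) = coord_p a z" "fst (fst z2) = coord_q a z"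
    "fst (fst (snd z2)) = coord_x i a M S z"
    by (simp_all add: z2_def z1_def shear_def rectify_def coord_u_def coord_p_def coord_q_def coord_x_def)
  have u: "snd (fst (snd z2)) / (M / (4 * S)) = 4 * pi * coord_u M S z"
    unfolding z2(1)[symmetric] using M S by (simp add: field_simps)
  have 3: "symplectic_at ?W z2"
  proof (rule symplectic_at_wrap)
    show "(turn S has_real_derivative turn' S (fst (fst (snd z2)))) (at (fst (fst (snd z2))))"
      by (rule turn_has_derivative[OF S])
    show "(?v has_real_derivative level' a M (coord_u M S z) * ?k) (at (snd (fst (snd z2))))"
      unfolding z2(1)[symmetric] by (rule DERIV_chain2[OF level_has_derivative[OF a] lin])
    show "(ramp a has_real_derivative ramp' a (4 * pi * coord_u M S z - coord_p a z)) (at (snd (fst (snd z2)) / (M / (4 * S)) - snd (fst z2)))"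
      unfolding u z2(2) by (rule ramp_has_derivative[OF a])
    \<comment> \<open>On the loop the angle does not turn; elsewhere the point lies in the band,
      where level and ramp are stationary.\<close>
    show "turn' S (fst (fst (snd z2))) = 0 \<or>
        (level' a M (coord_u M S z) * ?k = 0 \<and> ramp' a (4 * pi * coord_u M S z - coord_p a z) = 0)"
    proof (cases "\<bar>coord_x i a M S z\<bar> < S")
      case True
      then show ?thesis using turn_eq_0(2)[OF S] z2(4) by simp
    next
      case False
      define w n where "w = frac (coord_u M S z)" and "n = \<lfloor>coord_u M S z\<rfloor>"
      have w: "0 < w" "w < a" using band_or_loop[OF z] False by (auto simp: w_def)
      have u_eq: "coord_u M S z = w + of_int n" by (simp add: w_def n_def frac_def)
      have "level' a M (coord_u M S z) = level' a M w"
        unfolding u_eq by (rule level'_add_int[OF a])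
      moreover have "4 * pi * coord_u M S z - coord_p a z = 4 * pi * w - coord_p a z + 4 * pi * of_int n"
        by (simp add: u_eq algebra_simps)
      then have "ramp' a (4 * pi * coord_u M S z - coord_p a z) = ramp' a (4 * pi * w - coord_p a z)"
        by (simp only: ramp'_add_period[OF a])
      ultimately show ?thesis
        using level'_eq_0[OF a, of w M] ramp_eq_0(2)[OF a, of w "coord_p a z"] w c a by simp
    qed
  qed (use M S in auto)
  have z3: "fst (fst z3) = action1 a M S z" "fst (fst (snd z3)) = action2 i a M S z"
    unfolding z3_def wrap_def Let_def case_prod_beta u z2 fst_conv snd_conv action1_def action2_def height_def
    by (simp_all add: algebra_simps)
  have 4: "symplectic_at (polar l) z3"
    by (rule symplectic_at_polar) (use z3 action_bounds[OF z] l in auto)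
  have 12: "symplectic_at (\<lambda>z. shear i ?g ?g' (?R z)) z"
    using symplectic_at_compose[OF 1 2[unfolded z1_def]] .
  have 123: "symplectic_at (\<lambda>z. ?W (shear i ?g ?g' (?R z))) z"
    using symplectic_at_compose[OF 12 3[unfolded z2_def z1_def]] .
  show ?thesis
    unfolding embedding_def[abs_def] using symplectic_at_compose[OF 123 4[unfolded z3_def z2_def z1_def]] .
qed

end

text \<open>Parameters and point are all functions on one normed space, so that the same statement
  covers a single embedding and the whole family.\<close>

lemma smooth_on_embedding:
  fixes z :: "'b::real_normed_vector \<Rightarrow> 'k::finite pt"
  assumes U: "open U" and sm: "smooth_on a U" "smooth_on M U" "smooth_on S U" "smooth_on l U" "smooth_on z U"
    and par: "\<And>x. x \<in> U \<Longrightarrow> 0 < a x \<and> a x \<le> 1/24 \<and> 0 < M x \<and> 0 < S x \<and> 0 < l x \<and> z x \<in> source_set (S x)"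
  shows "smooth_on (\<lambda>x. embedding i (a x) (M x) (S x) (l x) (z x)) U"
proof -
  note bl = smooth_on_linear_comp[OF _ sm(5) U]
  have z: "smooth_on (\<lambda>x. fst (fst (z x))) U" "smooth_on (\<lambda>x. snd (fst (z x))) U"
    "smooth_on (\<lambda>x. fst (fst (snd (z x)))) U" "smooth_on (\<lambda>x. snd (fst (snd (z x)))) U"
    "\<And>j. smooth_on (\<lambda>x. fst (snd (snd (z x))) $ j) U" "\<And>j. smooth_on (\<lambda>x. snd (snd (snd (z x))) $ j) U"
    by (rule bl, intro bounded_linear_compose[OF bounded_linear_fst] bounded_linear_compose[OF bounded_linear_snd]
        bounded_linear_compose[OF bounded_linear_vec_nth] bounded_linear_fst bounded_linear_snd)+
  note intros = smooth_on_add smooth_on_diff smooth_on_mult smooth_on_divide smooth_on_const U sm(1-4) z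
  have amp: "smooth_on (\<lambda>x. amp (a x)) U"
    unfolding amp_def by (intro intros) (use par in force)
  have y: "\<bar>snd (fst (z x))\<bar> < 1" "0 < sqrt (1 - (snd (fst (z x)))\<^sup>2)" if "x \<in> U" for x
    using source_set_bounds(1,2)[of "z x" "S x"] par[OF that] by linarith+
  have yT: "(\<lambda>x. snd (fst (z x))) ` U \<subseteq> {-1<..<1}"
    using y(1) by (auto simp: abs_less_iff)
  have q: "smooth_on (\<lambda>x. coord_q (a x) (z x)) U"
    unfolding coord_q_def
    by (intro intros amp smooth_on_compose[OF smooth_on_sqrt_disc _ _ _ yT]) (use par y(2) in \<open>force+\<close>)
  have p: "smooth_on (\<lambda>x. coord_p (a x) (z x)) U"
    unfolding coord_p_def by (intro intros smooth_on_compose[OF smooth_on_disc_area _ _ _ yT]) auto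
  have M0: "pi * M x \<noteq> 0" if "x \<in> U" for x
    using par[OF that] by simp
  have u: "smooth_on (\<lambda>x. coord_u (M x) (S x) (z x)) U"
    unfolding coord_u_def by (intro intros M0)
  have a01: "0 < a x \<and> a x < 1" if "x \<in> U" for x
    using par[OF that] by auto
  note stair_intros = smooth_on_stair(1)[OF _ sm(1) U a01] smooth_on_stair(2)[OF _ sm(1) U a01]
  have x: "smooth_on (\<lambda>x. coord_x i (a x) (M x) (S x) (z x)) U"
    unfolding coord_x_def by (intro intros stair_intros u M0)
  have wave: "smooth_on (\<lambda>x. wave (a x) (f x)) U" if "smooth_on f U" for f
    unfolding wave_def by (intro intros stair_intros that)
  have ramp: "smooth_on (\<lambda>x. ramp (a x) (4 * pi * coord_u (M x) (S x) (z x) - coord_p (a x) (z x))) U"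
    unfolding ramp_def by (intro intros amp wave u p) auto
  have turn: "smooth_on (\<lambda>x. turn (S x) (coord_x i (a x) (M x) (S x) (z x))) U"
    unfolding turn_def by (intro intros smooth_on_stair(1) x) (use par in force)+
  have A1: "smooth_on (\<lambda>x. action1 (a x) (M x) (S x) (z x)) U"
    unfolding action1_def by (intro intros q ramp)
  have A2: "smooth_on (\<lambda>x. action2 i (a x) (M x) (S x) (z x)) U"
    unfolding action2_def height_def level_def by (intro intros amp x u turn wave ramp stair_intros) (use par in force)+
  have T: "smooth_on (\<lambda>x. angle2 i (a x) (M x) (S x) (z x)) U"
    unfolding angle2_def by (intro intros u turn)
  have r1: "smooth_on (\<lambda>x. sqrt (2 * action1 (a x) (M x) (S x) (z x))) U"
    by (intro smooth_on_sqrt_comp intros A1) (use par in \<open>auto intro!: action_bounds(1)\<close>)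
  have r2: "smooth_on (\<lambda>x. sqrt (2 * action2 i (a x) (M x) (S x) (z x))) U"
    by (intro smooth_on_sqrt_comp intros A2) (use par in \<open>auto intro!: action_bounds(2)\<close>)
  have "smooth_on (\<lambda>x.
    ((sqrt (2 * action1 (a x) (M x) (S x) (z x)) * cos (coord_p (a x) (z x)), sqrt (2 * action1 (a x) (M x) (S x) (z x)) * sin (coord_p (a x) (z x))),
     (sqrt (2 * action2 i (a x) (M x) (S x) (z x)) * cos (angle2 i (a x) (M x) (S x) (z x)), sqrt (2 * action2 i (a x) (M x) (S x) (z x)) * sin (angle2 i (a x) (M x) (S x) (z x))),
     ((1 / l x) *\<^sub>R (fst (snd (snd (z x))) + (2 * S x * stair (a x) (coord_u (M x) (S x) (z x))) *\<^sub>R axis i 1), l x *\<^sub>R snd (snd (snd (z x)))))) U"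
  proof (intro smooth_on_Pair U)
    show "smooth_on (\<lambda>x. (1 / l x) *\<^sub>R (fst (snd (snd (z x))) + (2 * S x * stair (a x) (coord_u (M x) (S x) (z x))) *\<^sub>R axis i 1)) U"
      by (rule smooth_on_vec[OF _ U])
        (simp del: times_divide_eq_left, intro intros stair_intros u, use par in force)
    show "smooth_on (\<lambda>x. l x *\<^sub>R snd (snd (snd (z x)))) U"
      by (rule smooth_on_vec[OF _ U]) (simp, intro intros)
  qed (intro smooth_on_mult U r1 r2 smooth_on_compose[OF smooth_on_cos] smooth_on_compose[OF smooth_on_sin] p T; simp)+
  then show ?thesis
  proof (rule smooth_on_cong)
    fix x assume "x \<in> U"
    then have "0 < M x" "0 < S x" using par by auto
    from embedding_eq[OF this, symmetric]
    show "((sqrt (2 * action1 (a x) (M x) (S x) (z x)) * cos (coord_p (a x) (z x)), sqrt (2 * action1 (a x) (M x) (S x) (z x)) * sin (coord_p (a x) (z x))),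
     (sqrt (2 * action2 i (a x) (M x) (S x) (z x)) * cos (angle2 i (a x) (M x) (S x) (z x)), sqrt (2 * action2 i (a x) (M x) (S x) (z x)) * sin (angle2 i (a x) (M x) (S x) (z x))),
     ((1 / l x) *\<^sub>R (fst (snd (snd (z x))) + (2 * S x * stair (a x) (coord_u (M x) (S x) (z x))) *\<^sub>R axis i 1), l x *\<^sub>R snd (snd (snd (z x))))) = embedding i (a x) (M x) (S x) (l x) (z x)" .
  qed
qed

lemma open_source_set: "open (source_set S :: 'k::finite pt set)"
  unfolding source_set_def by (intro open_Collect_conj open_Collect_less continuous_intros)

lemma symplectic_embedding_embedding:
  assumes a: "0 < a" "a \<le> 1/24" and M: "0 < M" and S: "0 < S" and l: "0 < l"
  shows "symplectic_embedding (embedding i a M S l) (source_set S :: 'k::finite pt set)"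
proof -
  have sm: "smooth_on (embedding i a M S l) (source_set S)"
    using smooth_on_embedding[of "source_set S" "\<lambda>_. a" "\<lambda>_. M" "\<lambda>_. S" "\<lambda>_. l" "\<lambda>z. z" i]
      open_source_set smooth_on_const smooth_on_bounded_linear[OF bounded_linear_ident] assms by auto
  have inj: "inj_on (embedding i a M S l) (source_set S)"
    by (rule inj_on_embedding[OF a M S]) (use l in simp)
  \<comment> \<open>Continuity of the inverse comes from invariance of domain.\<close>
  have "\<exists>\<psi>. homeomorphism (source_set S) (embedding i a M S l ` source_set S) (embedding i a M S l) \<psi>"
    using invariance_of_domain_homeomorphism[OF open_source_set smooth_on_imp_continuous_on[OF sm open_source_set] _ inj]
    by auto
  moreover have "\<forall>z\<in>source_set S. symplectic_at (embedding i a M S l) z"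
    using symplectic_at_embedding[OF a M S] l by (metis less_irrefl)
  ultimately show ?thesis
    using sm inj unfolding symplectic_embedding_def symplectic_at_def by blast
qed

text \<open>The values of \<open>a\<close> and \<open>M\<close> keep 36a + 21M/2 below 3d, hence
  below R^2 - 3; the denominator 1 + d ensures a \<le> 1/24 for every d > 0. The shear moves the
  x-half of the last factor by order S^3 / d while the y-half has size S, and l = S / sqrt d brings
  both to order S^2 / sqrt d. Since d < S^2, lower order terms are absorbed and the constants add up
  to 9 + 1.\<close>

lemma embedding_in_target_set:
  fixes z :: "'k::finite pt"
  assumes R: "sqrt 3 < R" "R < sqrt 3 + S\<^sup>2" and S: "0 < S" and z: "z \<in> source_set S"
  defines "d \<equiv> R - sqrt 3"
  shows "embedding i (d / (24 * (1 + d))) (d / 8) S (S / sqrt d) z \<in> target_set 10 S R"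
proof -
  define a M l where "a = d / (24 * (1 + d))" and "M = d / 8" and "l = S / sqrt d"
  have d: "0 < d" "d < S\<^sup>2" using R by (auto simp: d_def)
  have a: "0 < a" "a \<le> 1/24" "a \<le> d / 24" and M: "0 < M" and l: "0 < l"
    using d S by (auto simp: a_def M_def l_def field_simps)
  let ?A1 = "action1 a M S z" and ?A2 = "action2 i a M S z" and ?u = "coord_u M S z"
  note A = action_bounds(1)[OF a(1,2) M S z] action_bounds(2,3)[OF a(1,2) M S z, of i] and b = source_set_bounds[OF z]
  let ?w = "embedding i a M S l z"
  have "(norm (fst ?w, fst (snd ?w)))\<^sup>2 = 2 * ?A1 + 2 * ?A2"
  proof -
    have "(sqrt (2 * r) * cos t)\<^sup>2 + (sqrt (2 * r) * sin t)\<^sup>2 = 2 * r" if "0 < r" for r t :: real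
      using that by (simp add: power_mult_distrib distrib_left[symmetric])
    then show ?thesis
      unfolding embedding_eq[OF M S] norm_prod_def fst_conv snd_conv using A(1,2) by (simp add: add_nonneg_nonneg)
  qed
  also have "\<dots> < 6 * amp a + 21/2 * M" by (rule A(3))
  \<comment> \<open>This uses 1 / (1 - 6a) \<le> 1 + 12a, valid for 0 \<le> a \<le> 1/12.\<close>
  also have "\<dots> \<le> 3 + 36 * a + 21/2 * M"
  proof -
    have "0 \<le> 6 * a * (1 - 12 * a)" using a by simp
    then have "3 \<le> (3 + 36 * a) * (1 - 6 * a)" by (simp add: algebra_simps)
    then have "3 / (1 - 6 * a) \<le> 3 + 36 * a" using a by (simp add: divide_le_eq)
    moreover have "6 * amp a = 3 / (1 - 6 * a)" unfolding amp_def using a by (simp add: field_simps)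
    ultimately have "6 * amp a \<le> 3 + 36 * a" by simp
    then show ?thesis by simp
  qed
  also have "\<dots> \<le> 3 + 3 * d"
    using a(3) d by (simp add: M_def)
  also have "\<dots> \<le> R\<^sup>2"
  proof -
    have "3/2 \<le> sqrt 3" by (rule real_le_rsqrt) (simp add: power2_eq_square)
    then have "3/2 * d \<le> sqrt 3 * d" using d by simp
    moreover have "R\<^sup>2 = 3 + 2 * (sqrt 3 * d) + d\<^sup>2"
      using power2_sum[of "sqrt 3" d] by (simp add: d_def)
    ultimately show ?thesis using zero_le_power2[of d] by linarith
  qed
  finally have 1: "norm (fst ?w, fst (snd ?w)) < R"
    using R by (meson power2_less_imp_less less_imp_le less_trans real_sqrt_gt_zero zero_less_numeral)
  have "\<bar>?u\<bar> \<le> 3 * S\<^sup>2 / d"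
  proof -
    have "\<bar>?u\<bar> = \<bar>snd (fst (snd z))\<bar> * (S / (pi * M))"
      using M S by (simp add: coord_u_def abs_mult)
    also have "\<dots> \<le> S * (S / (pi * M))"
      using b(4) M S by (intro mult_right_mono) auto
    also have "\<dots> = (8 * S\<^sup>2 / d) / pi"
      by (simp add: M_def power2_eq_square mult_ac)
    \<comment> \<open>Replacing \<pi> by the smaller 8/3 makes the constant exactly 3.\<close>
    also have "\<dots> \<le> (8 * S\<^sup>2 / d) / (8/3)"
      using pi_gt3 d by (intro divide_left_mono) auto
    finally show ?thesis by simp
  qed
  moreover have "\<bar>stair a ?u\<bar> \<le> \<bar>?u\<bar> + 1"
    using stair_bounds(1)[of ?u a] stair_bounds(2)[of a ?u] by linarith
  ultimately have st: "\<bar>stair a ?u\<bar> \<le> 3 * S\<^sup>2 / d + 1" by linarith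
  have sd: "0 < sqrt d" "sqrt d * sqrt d = d" using d by auto
  have "norm (fst (snd (snd z)) + (2 * S * stair a ?u) *\<^sub>R axis i 1) \<le>
      norm (fst (snd (snd z))) + 2 * S * \<bar>stair a ?u\<bar>"
    using norm_triangle_ineq[of "fst (snd (snd z))" "(2 * S * stair a ?u) *\<^sub>R axis i 1"] S
    by (simp add: abs_mult)
  also have "\<dots> \<le> S + 2 * S * (3 * S\<^sup>2 / d + 1)"
    using b(5) st S by (intro add_mono mult_left_mono) auto
  also have "\<dots> \<le> 9 * S * (S\<^sup>2 / d)"
  proof -
    have "1 \<le> S\<^sup>2 / d" using d by simp
    then have "S * 1 \<le> S * (S\<^sup>2 / d)" using S by (intro mult_left_mono) auto
    moreover have "S + 2 * S * (3 * S\<^sup>2 / d + 1) = 3 * S + 6 * (S * (S\<^sup>2 / d))"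
      by (simp add: algebra_simps)
    ultimately show ?thesis by linarith
  qed
  finally have X: "norm (fst (snd (snd z)) + (2 * S * stair a ?u) *\<^sub>R axis i 1) \<le> 9 * S * (S\<^sup>2 / d)" .
  have "norm (snd (snd ?w)) \<le> norm (fst (snd (snd ?w))) + norm (snd (snd (snd ?w)))"
    using norm_Pair_le[of "fst (snd (snd ?w))" "snd (snd (snd ?w))"] by simp
  also have "\<dots> = 1 / l * norm (fst (snd (snd z)) + (2 * S * stair a ?u) *\<^sub>R axis i 1) + l * norm (snd (snd (snd z)))"
    using l by (simp add: embedding_eq[OF M S])
  also have "\<dots> < 1 / l * (9 * S * (S\<^sup>2 / d)) + l * S"
    using X b(6) l by (intro add_le_less_mono mult_left_mono mult_strict_left_mono) auto
  also have "\<dots> = 10 * S\<^sup>2 / sqrt d"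
    using S sd by (simp add: l_def field_simps power2_eq_square)
  finally have 2: "norm (snd (snd ?w)) < 10 * S\<^sup>2 / sqrt (R - sqrt 3)"
    by (simp add: d_def)
  show ?thesis
    using 1 2 by (simp add: target_set_def a_def M_def l_def)
qed

theorem theorem5p2:
  shows "\<exists>C C'. C > 0 \<and> C' > 0 \<and>
    (\<exists>i :: real \<Rightarrow> real \<Rightarrow> 'k::finite pt \<Rightarrow> 'k pt.
       smooth_on (\<lambda>(p, z). i (fst p) (snd p) z)
                 {(p, z). p \<in> param_set C' \<and> z \<in> source_set (fst p)} \<and>
       (\<forall>S R. (S, R) \<in> param_set C' \<longrightarrow>
          symplectic_embedding (i S R) (source_set S) \<and>
          i S R ` source_set S \<subseteq> target_set C S R))"
proof -
  define i :: "real \<Rightarrow> real \<Rightarrow> 'k pt \<Rightarrow> 'k pt" where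
    \<comment> \<open>Any index of the last factor will do, hence \<open>undefined\<close>.\<close>
    "i S R = embedding undefined ((R - sqrt 3) / (24 * (1 + (R - sqrt 3)))) ((R - sqrt 3) / 8) S (S / sqrt (R - sqrt 3))" for S R
  let ?U = "{(p, z). p \<in> param_set 1 \<and> z \<in> source_set (fst p)} :: ((real \<times> real) \<times> 'k pt) set"
  have U: "open ?U"
    unfolding param_set_def source_set_def case_prod_beta mem_Collect_eq
    by (intro open_Collect_conj open_Collect_less continuous_intros)
  have par: "0 < d / (24 * (1 + d)) \<and> d / (24 * (1 + d)) \<le> 1/24 \<and> 0 < d / 8 \<and> 0 < S / sqrt d" if "0 < d" "0 < S" for d S :: real
    using that by (auto simp: field_simps)
  have S: "smooth_on (\<lambda>x. fst (fst x)) ?U" and R: "smooth_on (\<lambda>x. snd (fst x)) ?U" and z: "smooth_on snd ?U"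
    by (intro smooth_on_bounded_linear bounded_linear_compose[OF bounded_linear_fst] bounded_linear_compose[OF bounded_linear_snd]
        bounded_linear_fst bounded_linear_snd)+
  have d: "smooth_on (\<lambda>x. snd (fst x) - sqrt 3) ?U"
    by (intro smooth_on_diff R smooth_on_const U)
  have "smooth_on (\<lambda>x. i (fst (fst x)) (snd (fst x)) (snd x)) ?U"
    unfolding i_def
  proof (rule smooth_on_embedding[OF U])
    show "smooth_on (\<lambda>x. (snd (fst x) - sqrt 3) / (24 * (1 + (snd (fst x) - sqrt 3)))) ?U"
      by (intro smooth_on_divide smooth_on_mult smooth_on_add smooth_on_const d U) (auto simp: param_set_def)
    show "smooth_on (\<lambda>x. fst (fst x) / sqrt (snd (fst x) - sqrt 3)) ?U"
      by (intro smooth_on_divide smooth_on_sqrt_comp d S U) (auto simp: param_set_def)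
    show "smooth_on (\<lambda>x. (snd (fst x) - sqrt 3) / 8) ?U"
      by (intro smooth_on_divide smooth_on_const d U) auto
    fix x :: "(real \<times> real) \<times> 'k pt"
    assume "x \<in> ?U"
    then have "0 < snd (fst x) - sqrt 3" "0 < fst (fst x)" "snd x \<in> source_set (fst (fst x))"
      by (auto simp: param_set_def)
    then show "0 < (snd (fst x) - sqrt 3) / (24 * (1 + (snd (fst x) - sqrt 3))) \<and>
        (snd (fst x) - sqrt 3) / (24 * (1 + (snd (fst x) - sqrt 3))) \<le> 1 / 24 \<and>
        0 < (snd (fst x) - sqrt 3) / 8 \<and> 0 < fst (fst x) \<and>
        0 < fst (fst x) / sqrt (snd (fst x) - sqrt 3) \<and> snd x \<in> source_set (fst (fst x))"
      using par by blast
  qed (rule S z)+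
  then have "smooth_on (\<lambda>(p, z). i (fst p) (snd p) z) ?U"
    by (simp add: case_prod_beta')
  moreover have "symplectic_embedding (i S R) (source_set S) \<and> i S R ` source_set S \<subseteq> target_set 10 S R"
    if "(S, R) \<in> param_set 1" for S R
  proof -
    have *: "0 < R - sqrt 3" "0 < S" "sqrt 3 < R" "R < sqrt 3 + S\<^sup>2"
      using that by (auto simp: param_set_def)
    show ?thesis
      unfolding i_def using par[OF *(1,2)] *(2) embedding_in_target_set[OF *(3,4,2)]
      by (auto intro!: symplectic_embedding_embedding)
  qed
  ultimately show ?thesis
    by (intro exI[of _ 10] exI[of _ 1] conjI exI[of _ i] allI impI) (simp_all only: zero_less_numeral zero_less_one)
qed

end
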